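(* Let $q$ be a prime power, let $n\ge 1$, $r\ge 2$ and $a$ be integers with $1\le a\le r-1$, let $V$ be an $r$-dimensional $\mathbb{F}_{q^n}$-vector space, and let $U$ be an $\mathbb{F}_q$-subspace of $V$ with $\dim_{\mathbb{F}_q}U=an$, defining the $\mathbb{F}_q$-linear set $L_U$ of rank $an$ in $\mathrm{PG}(V,\mathbb{F}_{q^n})=\mathrm{PG}(r-1,q^n)$. Let $w$ be the largest integer such that every point of $L_U$ has weight at least $w$, and suppose $w\ge 2$. Then $w\mid n$ and $U$ is $\mathbb{F}_{q^w}$-linear, i.e. $U$ is an $\mathbb{F}_{q^w}$-subspace of $V$.
   Context: For an $\mathbb{F}_q$-subspace $U$ of an $\mathbb{F}_{q^n}$-vector space $V$ with $\dim_{\mathbb{F}_q} U=m$, the $\mathbb{F}_q$-linear set of rank $m$ defined by $U$ is the set of points $L_U=\{\langle \mathbf{u}\rangle_{\mathbb{F}_{q^n}} : \mathbf{u}\in U\setminus\{\mathbf{0}\}\}$ of $\mathrm{PG}(V,\mathbb{F}_{q^n})$. The weight of a point $P=\langle \mathbf{v}\rangle_{\mathbb{F}_{q^n}}$ with respect to $L_U$ is $w_{L_U}(P)=\dim_{\mathbb{F}_q}(\langle \mathbf{v}\rangle_{\mathbb{F}_{q^n}}\cap U)$. *)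

theory Defs
  imports "HOL-Number_Theory.Prime_Powers"
begin

text \<open>
  The extension of finite fields is a unital ring homomorphism \<open>\<iota>\<close> (automatically injective)
  from the small field \<open>'f\<close> to the big field \<open>'k\<close>.  A vector space over \<open>'k\<close> is given
  by its scalar multiplication \<open>scale\<close>, as in the locale \<^locale>\<open>vector_space\<close>; composing with
  \<open>\<iota>\<close> makes it a vector space over \<open>'f\<close>, so that the library's notions of subspace
  and dimension apply over both fields.
\<close>

definition field_embedding :: "('f::field \<Rightarrow> 'k::field) \<Rightarrow> bool" where
  "field_embedding \<iota> \<longleftrightarrow>
     \<iota> 1 = 1 \<and> (\<forall>x y. \<iota> (x + y) = \<iota> x + \<iota> y) \<and> (\<forall>x y. \<iota> (x * y) = \<iota> x * \<iota> y)"

definition restrict_scalars :: "('f \<Rightarrow> 'k) \<Rightarrow> ('k \<Rightarrow> 'v \<Rightarrow> 'v) \<Rightarrow> 'f \<Rightarrow> 'v \<Rightarrow> 'v" where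
  "restrict_scalars \<iota> scale = (\<lambda>c v. scale (\<iota> c) v)"

lemma vector_space_restrict_scalars:
  assumes "field_embedding \<iota>" and "vector_space scale"
  shows "vector_space (restrict_scalars \<iota> scale)"
proof -
  interpret vector_space scale by fact
  from assms(1) show ?thesis
    by unfold_locales
      (simp_all add: restrict_scalars_def field_embedding_def scale_left_distrib scale_right_distrib)
qed

definition linear_set :: "('k::field \<Rightarrow> 'v::ab_group_add \<Rightarrow> 'v) \<Rightarrow> 'v set \<Rightarrow> 'v set set" where
  "linear_set scale U = {module.span scale {u} | u. u \<in> U - {0}}"

text \<open>A point of the projective space is the one-dimensional subspace \<open>P\<close>, as a set of vectors.\<close>

definition point_weight ::
  "('f::field \<Rightarrow> 'k::field) \<Rightarrow> ('k \<Rightarrow> 'v::ab_group_add \<Rightarrow> 'v) \<Rightarrow> 'v set \<Rightarrow> 'v set \<Rightarrow> nat" where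
  "point_weight \<iota> scale U P = vector_space.dim (restrict_scalars \<iota> scale) (P \<inter> U)"

text \<open>
  The intermediate field of order \<open>q ^ w\<close> occurs only existentially, so it is a subset
  of \<open>'k\<close> rather than a type.
\<close>

definition is_subfield :: "'k::field set \<Rightarrow> bool" where
  "is_subfield K \<longleftrightarrow> 0 \<in> K \<and> 1 \<in> K
     \<and> (\<forall>x\<in>K. \<forall>y\<in>K. x + y \<in> K \<and> x * y \<in> K)
     \<and> (\<forall>x\<in>K. - x \<in> K \<and> inverse x \<in> K)"

definition subspace_over ::
  "('k::field \<Rightarrow> 'v::ab_group_add \<Rightarrow> 'v) \<Rightarrow> 'k set \<Rightarrow> 'v set \<Rightarrow> bool" where
  "subspace_over scale K U \<longleftrightarrow> 0 \<in> U
     \<and> (\<forall>u\<in>U. \<forall>v\<in>U. u + v \<in> U) \<and> (\<forall>c\<in>K. \<forall>u\<in>U. scale c u \<in> U)"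

end

theory Submission
  imports Defs "HOL-Computational_Algebra.Polynomial" "HOL-Library.Cardinality"
begin

text \<open>
  Write \<open>p\<close> for the characteristic and \<open>p ^ N\<close> for the order of the big field \<open>K\<close>.

  The problem reduces to a single additive map of \<open>K\<close>.  Counting vectors yields a \<open>K\<close>-subspace \<open>C\<close>
  that is a complement of \<open>U\<close> as an additive group (\<open>complement_avoiding\<close>), so \<open>U\<close> is the graph of an
  additive map: let \<open>\<gamma> v\<close> be the element of \<open>C\<close> with \<open>v + \<gamma> v \<in> U\<close>.  Then \<open>\<gamma>\<close> commutes with
  a scalar \<open>c\<close> on all of \<open>V\<close> only if \<open>c U \<subseteq> U\<close>, and the hypothesis on weights says that for each
  vector \<open>y\<close> at least \<open>q ^ w\<close> scalars \<open>c\<close> satisfy \<open>\<gamma> (c y) = c \<gamma> y\<close>.  For a \<open>K\<close>-linear functional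
  \<open>\<phi>\<close> and a vector \<open>y\<close>, the map \<open>l \<mapsto> \<phi> (\<gamma> (l y))\<close> is an additive map \<open>K \<rightarrow> K\<close>, that is, a
  polynomial \<open>f = \<Sum>k<N. a k * l ^ p ^ k\<close>.  Since \<open>K\<close> has more than \<open>N\<close> elements, some pair
  \<open>(\<phi>, y)\<close> makes all those coefficients nonzero that are nonzero for any pair, so the exponents in
  this single \<open>f\<close> control \<open>\<gamma>\<close> (\<open>linear_over_fixed_field\<close>).

  For such an \<open>f\<close> and each direction \<open>y\<close>, the equation \<open>f x = y x\<close> has at least \<open>p ^ W = q ^ w\<close>
  solutions \<open>x\<close> as soon as it has one with \<open>x \<noteq> 0\<close>; call \<open>y\<close> determined in that case.  The Redei polynomial \<open>\<Prod>x. X - (f x - x Y)\<close> is additive in \<open>X\<close>.  At a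
  determined direction it has a zero of order at least \<open>p ^ W\<close> at \<open>X = 0\<close>; at any other
  direction it is \<open>X ^ p ^ N - X\<close>.  After subtraction of \<open>X ^ p ^ N - X\<close>, the coefficient \<open>\<rho> j\<close> of
  \<open>X ^ p ^ j\<close> therefore vanishes at every \<open>y \<in> K\<close> if \<open>0 < j < W\<close>, and its degree in \<open>Y\<close> is too
  small for that unless it is the zero polynomial.  On the other hand, each \<open>f x - x Y\<close> is a zero
  of the Redei polynomial; comparing the coefficients of \<open>x ^ p ^ i\<close> gives, for \<open>0 < i < N\<close>,
  \<open>\<Sum>j<N. a ((i - j) mod N) ^ p ^ j * \<rho> j = \<rho> i * Y ^ p ^ i\<close>.  This relation forces the nonzero
  \<open>\<rho> j\<close> to have pairwise distinct degrees, because \<open>deg \<rho> 0 - deg \<rho> j\<close> is a sum of distinct powers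
  of \<open>p\<close> that records a path from \<open>0\<close> to \<open>j\<close> (\<open>degrees_distinct\<close>).  Hence no cancellation occurs:
  \<open>\<rho> j \<noteq> 0\<close> and \<open>a k \<noteq> 0\<close> imply \<open>\<rho> ((j + k) mod N) \<noteq> 0\<close>.  So the index of some \<open>\<rho> j \<noteq> 0\<close> is, modulo
  \<open>N\<close>, the generator \<open>d\<close> of the subgroup of the integers modulo \<open>N\<close> spanned by the exponents of \<open>f\<close>, and
  \<open>d \<ge> W\<close> (\<open>support_multiple\<close>).  As \<open>d\<close> divides all the exponents, \<open>f\<close> is linear over the field
  with \<open>p ^ d\<close> elements.

  Finally, the set of scalars \<open>c\<close> with \<open>c U \<subseteq> U\<close> is a subfield of order \<open>q ^ m\<close>, and
  \<open>m \<ge> w\<close> by the above.  Each point of the linear set has weight at least \<open>m\<close>, hence \<open>m = w\<close> by the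
  maximality of \<open>w\<close>; and the degree of a subfield divides the degree of the field.
\<close>


section \<open>Powers in finite fields\<close>

text \<open>
  Multiplication by a nonzero \<open>x\<close> permutes the nonzero elements of the subfield, so it
  does not change their product.
\<close>

lemma subfield_power_card:
  fixes K :: "'k::{field,finite} set"
  assumes K: "is_subfield K" and "x \<in> K"
  shows "x ^ card K = x"
proof (cases "x = 0")
  case True
  have "card K > 0"
    using K by (auto simp: is_subfield_def card_gt_0_iff)
  then show ?thesis using True by simp
next
  case False
  have "(\<Prod>y\<in>K-{0}. x * y) = (\<Prod>y\<in>K-{0}. y)"
    by (rule prod.reindex_bij_witness[of _ "\<lambda>y. inverse x * y" "\<lambda>y. x * y"])
      (use False K \<open>x \<in> K\<close> in \<open>auto simp: is_subfield_def mult.assoc[symmetric]\<close>)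
  then have "x ^ (card K - 1) * \<Prod>(K-{0}) = 1 * \<Prod>(K-{0})"
    using K by (simp add: prod.distrib is_subfield_def)
  then have "x ^ (card K - 1) = 1"
    by (subst (asm) mult_right_cancel) auto
  moreover have "card K > 0"
    using K by (auto simp: is_subfield_def card_gt_0_iff)
  ultimately show ?thesis
    by (metis Suc_pred' mult.right_neutral power_Suc)
qed

lemma finite_field_power_card:
  fixes x :: "'k::{field,finite}"
  shows "x ^ CARD('k) = x"
  by (rule subfield_power_card) (auto simp: is_subfield_def)

lemma prime_CHAR_finite_field: "prime CHAR('k::{field,finite})"
  by (intro prime_CHAR_semidom finite_imp_CHAR_pos) auto

lemma CHAR_eq_of_card:
  assumes "prime p" and "CARD('k::{field,finite}) = p ^ m"
  shows "CHAR('k) = p"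
proof -
  have "(\<Sum>x\<in>UNIV. x + 1) = (\<Sum>x\<in>UNIV. x :: 'k)"
    by (rule sum.reindex_bij_witness[of _ "\<lambda>x. x - 1" "\<lambda>x. x + 1"]) auto
  then have "of_nat CARD('k) = (0 :: 'k)"
    by (simp add: sum.distrib)
  then have "CHAR('k) dvd p ^ m"
    using assms(2) by (metis of_nat_eq_0_iff_char_dvd)
  then show ?thesis
    using prime_CHAR_finite_field[where ?'k = 'k] assms(1)
    by (metis prime_dvd_power primes_dvd_imp_eq)
qed

lemma power_frobenius_mod:
  fixes x :: "'k::{field,finite}"
  assumes "CARD('k) = p ^ N"
  shows "x ^ (p ^ m) = x ^ (p ^ (m mod N))"
proof -
  have *: "z ^ (p ^ (N * j)) = z" for z :: 'k and j
    by (induction j) (simp_all add: power_add power_mult finite_field_power_card flip: assms)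
  have "x ^ (p ^ m) = (x ^ (p ^ (N * (m div N)))) ^ (p ^ (m mod N))"
    by (metis power_add power_mult mult_div_mod_eq)
  then show ?thesis by (simp add: *)
qed

section \<open>Additive polynomials and additive maps of a finite field\<close>

text \<open>
  In characteristic \<open>p\<close>, \<open>(1 + X) ^ (p ^ k * u) = (1 + X ^ p ^ k) ^ u\<close>; compare the
  coefficients of \<open>X ^ p ^ k\<close>.
\<close>

lemma of_nat_binomial_prime_power:
  assumes p: "prime CHAR('a::idom)"
  shows "of_nat (CHAR('a) ^ k * u choose CHAR('a) ^ k) = (of_nat u :: 'a)"
proof (cases "u = 0")
  case True
  then show ?thesis using p by (simp add: prime_gt_0_nat binomial_eq_0)
next
  case False
  let ?q = "CHAR('a) ^ k"
  have q: "?q > 0" using p by (simp add: prime_gt_0_nat)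
  have "[:1, 1 :: 'a:] ^ ?q = (monom 1 1 + 1) ^ ?q"
    by (simp add: monom_altdef one_pCons)
  also have "\<dots> = monom 1 ?q + 1"
    by (subst freshmans_dream'[where n = k]) (use p in \<open>simp_all add: monom_power\<close>)
  finally have "[:1, 1 :: 'a:] ^ (?q * u) = (monom 1 ?q + 1) ^ u"
    by (simp add: power_mult)
  also have "\<dots> = (\<Sum>j\<le>u. of_nat (u choose j) * monom 1 (?q * j))"
    by (simp add: binomial_ring monom_power)
  also have "coeff \<dots> ?q = (\<Sum>j\<le>u. if j = 1 then of_nat u else 0)"
    unfolding coeff_sum using q
    by (intro sum.cong) (auto simp: of_nat_poly)
  also have "\<dots> = of_nat u"
    using False by simp
  finally show ?thesis
    using False by (subst (asm) coeff_linear_poly_power) auto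
qed

lemma prime_power_of_zero_binomials:
  assumes p: "prime CHAR('a::idom)" and "m > 0"
    and zero: "\<And>i. 0 < i \<Longrightarrow> i < m \<Longrightarrow> of_nat (m choose i) = (0 :: 'a)"
  shows "\<exists>k. m = CHAR('a) ^ k"
proof -
  define k where "k = multiplicity CHAR('a) m"
  obtain u where u: "m = CHAR('a) ^ k * u" "\<not> CHAR('a) dvd u"
    using multiplicity_decompose'[of m "CHAR('a)"] p \<open>m > 0\<close> not_prime_unit
    unfolding k_def by blast
  have "u = 1"
  proof (rule ccontr)
    assume "u \<noteq> 1"
    then have "u > 1" using \<open>m > 0\<close> u(1) by (cases u) auto
    then have "of_nat (m choose CHAR('a) ^ k) = (0 :: 'a)"
      using p by (intro zero) (auto simp: u(1) prime_gt_0_nat)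
    then show False
      using u of_nat_binomial_prime_power[OF p, of k u] of_nat_eq_0_iff_char_dvd[where ?'a = 'a] by simp
  qed
  with u show ?thesis by auto
qed

text \<open>
  For fixed \<open>t\<close>, the polynomials \<open>P (X + t)\<close> and \<open>P X + P t\<close> agree, so for \<open>i > 0\<close> the coefficient
  of \<open>X ^ i\<close> in \<open>P (X + t)\<close>, a polynomial in \<open>t\<close>, is constant.  Thus \<open>coeff P m * (m choose i) = 0\<close>
  whenever \<open>0 < i < m\<close>, and these binomial coefficients all vanish only for powers of the
  characteristic.
\<close>

lemma additive_poly_coeff:
  fixes P :: "'a::idom poly"
  assumes add: "\<And>x t. poly P (x + t) = poly P x + poly P t"
    and big: "infinite (UNIV :: 'a set) \<or> degree P < CARD('a)"
    and p: "prime CHAR('a)" and m: "coeff P m \<noteq> 0"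
  shows "\<exists>k. m = CHAR('a) ^ k"
proof -
  obtain A :: "'a set" where A: "card A > degree P"
    using big infinite_arbitrarily_large[of "UNIV::'a set" "Suc (degree P)"] by (metis lessI)
  have eqI: "P1 = P2" if "\<And>x. poly P1 x = poly P2 x" "degree P1 \<le> degree P" "degree P2 \<le> degree P"
    for P1 P2 :: "'a poly"
    by (rule poly_eqI_degree[of A]) (use that A in auto)
  have zero: "of_nat (m choose i) = (0 :: 'a)" if "0 < i" "i < m" for i
  proof -
    \<comment> \<open>The coefficient of \<open>X ^ i\<close> in \<open>P (X + t)\<close>, as a polynomial in \<open>t\<close> (a Hasse derivative of \<open>P\<close>).\<close>
    define H where "H = (\<Sum>j\<le>degree P. monom (of_nat (j choose i) * coeff P j) (j - i))"
    have coeff_shift: "coeff (pcompose P [:t, 1:]) i = poly H t" for t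
    proof -
      have "pcompose P [:t, 1:] = (\<Sum>j\<le>degree P. smult (coeff P j) ([:t, 1:] ^ j))"
        by (rule eqI) (auto simp: poly_pcompose poly_sum poly_altdef[of P] add_ac degree_pcompose
            intro!: degree_sum_le order.trans[OF degree_smult_le] order.trans[OF degree_power_le])
      also have "coeff \<dots> i = (\<Sum>j\<le>degree P. coeff P j * (of_nat (j choose i) * t ^ (j - i)))"
        unfolding coeff_sum
      proof (rule sum.cong)
        fix j
        have "coeff ([:t, 1:] ^ j) i = of_nat (j choose i) * t ^ (j - i)"
        proof (cases "i \<le> j")
          case True
          then show ?thesis by (subst coeff_linear_poly_power) auto
        next
          case False
          then show ?thesis
            by (subst coeff_eq_0) (auto simp: degree_linear_power binomial_eq_0)
        qed
        then show "coeff (smult (coeff P j) ([:t, 1:] ^ j)) i = coeff P j * (of_nat (j choose i) * t ^ (j - i))"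
          by simp
      qed auto
      finally show ?thesis
        by (simp add: H_def poly_sum poly_monom mult_ac)
    qed
    have "pcompose P [:t, 1:] = P + [:poly P t:]" for t
      by (rule eqI) (auto simp: poly_pcompose add add.commute degree_pcompose intro!: degree_add_le)
    then have "poly H t = coeff P i" for t
      using coeff_shift[of t] \<open>0 < i\<close> by (simp add: coeff_pCons split: nat.splits)
    then have "H = [:coeff P i:]"
      by (intro eqI) (auto simp: H_def intro!: degree_sum_le order.trans[OF degree_monom_le])
    moreover have "coeff H (m - i) = of_nat (m choose i) * coeff P m"
    proof -
      have "coeff H (m - i) = (\<Sum>j\<le>degree P. if j = m then of_nat (m choose i) * coeff P m else 0)"
        unfolding H_def coeff_sum
      proof (intro sum.cong refl)
        fix j
        show "coeff (monom (of_nat (j choose i) * coeff P j) (j - i)) (m - i)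
            = (if j = m then of_nat (m choose i) * coeff P m else 0)"
          using that by (cases "j < i") (auto simp: binomial_eq_0)
      qed
      also have "\<dots> = of_nat (m choose i) * coeff P m"
        using le_degree[OF m] by simp
      finally show ?thesis .
    qed
    ultimately have "of_nat (m choose i) * coeff P m = 0"
      using that by (simp add: coeff_pCons split: nat.splits)
    then show ?thesis
      using m by simp
  qed
  have "poly P 0 = 0" using add[of 0 0] unfolding add_0 by (simp only: add_cancel_right_right)
  then have "m > 0" using m by (cases m) (auto simp: poly_0_coeff_0)
  then show ?thesis
    using prime_power_of_zero_binomials[OF p] zero by blast
qed

text \<open>
  Lagrange interpolation on the whole field: \<open>1 - (X - x) ^ (CARD('k) - 1)\<close> is the indicator of \<open>x\<close>.
\<close>

definition interp :: "('k::{field,finite} \<Rightarrow> 'k) \<Rightarrow> 'k poly" where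
  "interp h = (\<Sum>x\<in>UNIV. smult (h x) (1 - [:-x, 1:] ^ (CARD('k) - 1)))"

lemma card_field_ge2: "CARD('k::{field,finite}) \<ge> 2"
proof -
  have "card {0, 1 :: 'k} \<le> CARD('k)" by (rule card_mono) auto
  then show ?thesis by simp
qed

lemma power_card_minus_one:
  fixes x :: "'k::{field,finite}"
  shows "x ^ (CARD('k) - 1) = (if x = 0 then 0 else 1)"
proof (cases "x = 0")
  case True
  then show ?thesis using card_field_ge2[where ?'k = 'k] by simp
next
  case False
  have "x * x ^ (CARD('k) - 1) = x * 1"
    using finite_field_power_card[of x] card_field_ge2[where ?'k = 'k]
    by (metis One_nat_def Suc_pred' mult.right_neutral not_numeral_le_zero power_Suc neq0_conv)
  then show ?thesis using False by simp
qed

lemma poly_interp: "poly (interp h) z = h z"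
proof -
  have "poly (interp h) z = (\<Sum>x\<in>UNIV. if x = z then h x else 0)"
    unfolding interp_def poly_sum
    by (intro sum.cong) (auto simp: power_card_minus_one[simplified])
  then show ?thesis by simp
qed

lemma degree_interp: "degree (interp (h :: 'k::{field,finite} \<Rightarrow> 'k)) < CARD('k)"
proof -
  have "degree (interp h) \<le> CARD('k) - 1"
    unfolding interp_def
    by (intro degree_sum_le order.trans[OF degree_smult_le] degree_diff_le) (auto simp: degree_linear_power)
  then show ?thesis using card_field_ge2[where ?'k = 'k] by linarith
qed

text \<open>
  This is meant for additive \<open>h\<close>, whose interpolating polynomial has no further coefficients.
\<close>

definition frob_coeff :: "('k::{field,finite} \<Rightarrow> 'k) \<Rightarrow> nat \<Rightarrow> 'k" where
  "frob_coeff h k = coeff (interp h) (CHAR('k) ^ k)"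

lemma poly_additive_expansion:
  fixes P :: "'a::comm_ring_1 poly"
  assumes supp: "\<And>m. coeff P m \<noteq> 0 \<Longrightarrow> \<exists>k<M. m = p ^ k" and p: "p \<ge> 2"
  shows "poly P x = (\<Sum>k<M. coeff P (p ^ k) * x ^ (p ^ k))"
proof -
  have zero: "coeff P m = 0" if "m \<notin> (\<lambda>k. p ^ k) ` {..<M}" for m
    using supp that by blast
  have "poly P x = (\<Sum>m\<in>(\<lambda>k. p ^ k) ` {..<M} \<union> {..degree P}. coeff P m * x ^ m)"
    unfolding poly_altdef by (intro sum.mono_neutral_left) (auto simp: coeff_eq_0)
  also have "\<dots> = (\<Sum>m\<in>(\<lambda>k. p ^ k) ` {..<M}. coeff P m * x ^ m)"
    using zero by (intro sum.mono_neutral_right) auto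
  also have "\<dots> = (\<Sum>k<M. coeff P (p ^ k) * x ^ (p ^ k))"
    using p by (subst sum.reindex) (auto simp: inj_on_def)
  finally show ?thesis .
qed

lemma additive_expansion:
  fixes h :: "'k::{field,finite} \<Rightarrow> 'k"
  assumes N: "CARD('k) = CHAR('k) ^ N" and add: "\<And>x y. h (x + y) = h x + h y"
  shows "h x = (\<Sum>k<N. frob_coeff h k * x ^ (CHAR('k) ^ k))"
proof -
  note p = prime_CHAR_finite_field[where ?'k = 'k]
  have "h x = poly (interp h) x" by (simp add: poly_interp)
  also have "\<dots> = (\<Sum>k<N. coeff (interp h) (CHAR('k) ^ k) * x ^ (CHAR('k) ^ k))"
  proof (rule poly_additive_expansion)
    fix m assume m: "coeff (interp h) m \<noteq> 0"
    then obtain k where k: "m = CHAR('k) ^ k"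
      using additive_poly_coeff[of "interp h" m] add p degree_interp[of h]
      by (auto simp: poly_interp)
    have "m < CHAR('k) ^ N"
      using le_degree[OF m] degree_interp[of h] N by linarith
    then have "k < N"
      using k p by (metis power_strict_increasing_iff prime_gt_1_nat)
    with k show "\<exists>k<N. m = CHAR('k) ^ k" by blast
  qed (use p in \<open>auto simp: prime_ge_2_nat\<close>)
  finally show ?thesis by (simp add: frob_coeff_def)
qed

lemma frob_coeff_unique:
  fixes h :: "'k::{field,finite} \<Rightarrow> 'k"
  assumes N: "CARD('k) = CHAR('k) ^ N"
    and h: "\<And>x. h x = (\<Sum>k<N. b k * x ^ (CHAR('k) ^ k))" and "i < N"
  shows "frob_coeff h i = b i"
proof -
  note p = prime_gt_1_nat[OF prime_CHAR_finite_field[where ?'k = 'k]]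
  let ?P = "\<Sum>k<N. monom (b k) (CHAR('k) ^ k)"
  have "degree ?P \<le> CARD('k) - 1"
  proof (intro degree_sum_le order.trans[OF degree_monom_le])
    fix k assume "k \<in> {..<N}"
    then have "CHAR('k) ^ k < CARD('k)" using p by (simp add: N)
    then show "CHAR('k) ^ k \<le> CARD('k) - 1" by linarith
  qed auto
  then have deg: "degree ?P < CARD('k)"
    using card_field_ge2[where ?'k = 'k] by linarith
  have "interp h = ?P"
    by (rule poly_eqI_degree[of UNIV]) (use deg degree_interp[of h] in \<open>auto simp: poly_interp poly_sum poly_monom h\<close>)
  then show ?thesis
    using p \<open>i < N\<close> by (simp add: frob_coeff_def coeff_sum)
qed


section \<open>Propagation of nonvanishing along a recurrence with distinct powers\<close>

text \<open>
  If the summands of large degree have pairwise distinct degrees, the leading term of the largest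
  one cannot cancel.  Distinctness is demanded only from the degree of the sum upwards, so that the
  lemma can be applied inside a downward induction on the degree.
\<close>

lemma degree_sum_distinct:
  fixes f :: "'i \<Rightarrow> 'a::comm_monoid_add poly"
  assumes "finite I" and "\<exists>m\<in>I. f m \<noteq> 0"
    and distinct: "\<And>m k. m \<in> I \<Longrightarrow> f m \<noteq> 0 \<Longrightarrow> degree (sum f I) \<le> degree (f m) \<Longrightarrow>
      k \<in> I \<Longrightarrow> f k \<noteq> 0 \<Longrightarrow> degree (f k) = degree (f m) \<Longrightarrow> k = m"
  shows "sum f I \<noteq> 0 \<and> (\<exists>m\<in>I. f m \<noteq> 0 \<and> degree (f m) = degree (sum f I))"
proof -
  define J where "J = {m \<in> I. f m \<noteq> 0}"
  have J: "finite J" "J \<noteq> {}" using assms(1,2) by (auto simp: J_def)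
  define d where "d = Max ((\<lambda>m. degree (f m)) ` J)"
  have "d \<in> (\<lambda>m. degree (f m)) ` J" unfolding d_def using J by (intro Max_in) auto
  then obtain m where m: "m \<in> J" "d = degree (f m)" by blast
  have max: "degree (f k) \<le> degree (f m)" if "k \<in> J" for k
    unfolding m(2)[symmetric] d_def using J that by (intro Max_ge) auto
  have mI: "m \<in> I" "f m \<noteq> 0" using m(1) by (auto simp: J_def)
  have le: "degree (sum f I) \<le> degree (f m)"
  proof (rule degree_sum_le)
    fix k assume "k \<in> I"
    then show "degree (f k) \<le> degree (f m)"
      using max[of k] by (cases "f k = 0") (auto simp: J_def)
  qed fact
  have "coeff (sum f I) (degree (f m)) = (\<Sum>k\<in>I. if k = m then lead_coeff (f m) else 0)"
    unfolding coeff_sum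
  proof (intro sum.cong refl)
    fix k assume k: "k \<in> I"
    show "coeff (f k) (degree (f m)) = (if k = m then lead_coeff (f m) else 0)"
    proof (cases "k = m \<or> f k = 0")
      case False
      then have "degree (f k) \<noteq> degree (f m)"
        using distinct[OF mI le k] by blast
      then have "degree (f k) < degree (f m)"
        using max[of k] k False by (auto simp: J_def)
      then show ?thesis using False by (simp add: coeff_eq_0)
    qed (use mI in auto)
  qed
  also have "\<dots> = lead_coeff (f m)" using assms(1) mI by simp
  finally have *: "coeff (sum f I) (degree (f m)) \<noteq> 0" using mI by simp
  then show ?thesis using le le_degree[OF *] mI by auto
qed

lemma sum_powers_less:
  assumes "(p::nat) \<ge> 2"
  shows "(\<Sum>v<n. p ^ v) < p ^ n"
proof (induction n)
  case (Suc n)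
  have "(\<Sum>v<Suc n. p ^ v) < 2 * p ^ n" using Suc by simp
  also have "\<dots> \<le> p ^ Suc n" using assms by simp
  finally show ?case .
qed simp

lemma sum_powers_inject:
  assumes "(p::nat) \<ge> 2" and "S \<subseteq> {..<n}" and "T \<subseteq> {..<n}"
    and "(\<Sum>v\<in>S. p ^ v) = (\<Sum>v\<in>T. p ^ v)"
  shows "S = T"
  using assms(2-)
proof (induction n arbitrary: S T)
  case (Suc n)
  have less: "(\<Sum>v\<in>A. p ^ v) < (\<Sum>v\<in>B. p ^ v)"
    if "A \<subseteq> {..<Suc n}" "B \<subseteq> {..<Suc n}" "n \<notin> A" "n \<in> B" for A B
  proof -
    have "A \<subseteq> {..<n}" using that by (auto simp: less_Suc_eq)
    then have "(\<Sum>v\<in>A. p ^ v) \<le> (\<Sum>v<n. p ^ v)"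
      by (intro sum_mono2) auto
    also have "\<dots> < p ^ n" by (rule sum_powers_less) fact
    also have "\<dots> \<le> (\<Sum>v\<in>B. p ^ v)"
      using that by (intro member_le_sum) (auto intro: finite_subset)
    finally show ?thesis .
  qed
  have iff: "n \<in> S \<longleftrightarrow> n \<in> T"
    using less[of S T] less[of T S] Suc.prems by auto
  have fin: "finite S" "finite T"
    using Suc.prems by (auto intro: finite_subset)
  have "(\<Sum>v\<in>S-{n}. p ^ v) = (\<Sum>v\<in>T-{n}. p ^ v)"
    using iff Suc.prems(3) fin by (cases "n \<in> S") (auto simp: sum.remove)
  then have "S - {n} = T - {n}"
    using Suc.prems by (intro Suc.IH) (auto simp: less_Suc_eq)
  with iff show ?case by auto
qed simp

lemma unshift_mod:
  assumes "j < N" and "k < N"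
  shows "((k + j) mod N + N - j) mod N = (k::nat)"
proof (cases "k + j < N")
  case True
  then have "(k + j) mod N + N - j = k + N" by simp
  then show ?thesis using assms by simp
next
  case False
  then have "(k + j) mod N = k + j - N"
    using assms by (simp add: le_mod_geq)
  then have "(k + j) mod N + N - j = k" using False by simp
  then show ?thesis using assms by simp
qed

lemma sum_shift_mod:
  fixes g h :: "nat \<Rightarrow> 'a::comm_semiring_0"
  assumes "j < N"
  shows "(\<Sum>k<N. g k * h ((k + j) mod N)) = (\<Sum>i<N. g ((i + N - j) mod N) * h i)"
proof (rule sum.reindex_bij_witness[of _ "\<lambda>i. (i + N - j) mod N" "\<lambda>k. (k + j) mod N"])
  have reshift: "((i + N - j) mod N + j) mod N = i" if "i < N" for i
  proof -
    have "((i + N - j) mod N + j) mod N = (i + N - j + j) mod N" by (rule mod_add_left_eq)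
    also have "i + N - j + j = i + N" using assms by simp
    finally show ?thesis using that by simp
  qed
  show "((k + j) mod N + N - j) mod N = k" if "k \<in> {..<N}" for k using unshift_mod[OF assms, of k] that by simp
  show "((i + N - j) mod N + j) mod N = i" if "i \<in> {..<N}" for i using reshift that by simp
  show "g (((k + j) mod N + N - j) mod N) * h ((k + j) mod N) = g k * h ((k + j) mod N)"
    if "k \<in> {..<N}" for k using unshift_mod[OF assms, of k] that by simp
qed (use assms in auto)

text \<open>
  The shifts modulo \<open>N\<close> that preserve \<open>Z\<close> form a subgroup: a negative shift is a multiple of a
  positive one.  Its generator \<open>d\<close> divides every element of \<open>T\<close>, and moves \<open>0 \<in> Z\<close> to \<open>d mod N\<close>.
\<close>

lemma closed_under_shifts:
  fixes Z T :: "nat set"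
  assumes Z: "Z \<subseteq> {..<N}" "0 \<in> Z"
    and shift: "\<And>j k. j \<in> Z \<Longrightarrow> k \<in> T \<Longrightarrow> (j + k) mod N \<in> Z"
  shows "\<exists>d>0. d dvd N \<and> (\<forall>k\<in>T. d dvd k) \<and> d mod N \<in> Z"
proof -
  define M where "M = {m. \<forall>j\<in>Z. (j + m) mod N \<in> Z}"
  have N: "N > 0" using Z by auto
  have M_mod: "m \<in> M \<longleftrightarrow> m' \<in> M" if "m mod N = m' mod N" for m m'
  proof -
    have "(j + m) mod N = (j + m') mod N" for j by (rule mod_add_cong[OF refl that])
    then show ?thesis by (simp add: M_def)
  qed
  have "0 \<in> M" using Z(1) by (auto simp: M_def)
  then have "N \<in> M" using M_mod[of N 0] by simp
  have M_add: "m + m' \<in> M" if "m \<in> M" "m' \<in> M" for m m'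
  proof -
    have "(j + (m + m')) mod N = ((j + m) mod N + m') mod N" for j
      by (simp add: mod_add_left_eq add.assoc)
    then show ?thesis using that by (simp add: M_def)
  qed
  have M_mult: "c * m \<in> M" if "m \<in> M" for c m
    by (induction c) (use \<open>0 \<in> M\<close> M_add that in auto)
  define d where "d = (LEAST m. m > 0 \<and> m \<in> M)"
  have d: "d > 0" "d \<in> M"
    using LeastI[of "\<lambda>m. m > 0 \<and> m \<in> M" N] N \<open>N \<in> M\<close> by (auto simp: d_def)
  have dvd: "d dvd m" if "m \<in> M" for m
  proof -
    \<comment> \<open>Modulo \<open>N\<close>, adding \<open>(N - 1) * z\<close> means subtracting \<open>z\<close>.\<close>
    have "m + (N - 1) * (m div d * d) = m mod d + N * (m div d * d)"
      using N by (cases N) (auto simp: algebra_simps)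
    moreover have "m + (N - 1) * (m div d * d) \<in> M"
      using M_add[OF that M_mult[OF M_mult[OF d(2)]]] by simp
    ultimately have "m mod d \<in> M"
      using M_mod[of "m mod d + N * (m div d * d)" "m mod d"] by simp
    then have "m mod d = 0"
      using not_less_Least[of "m mod d" "\<lambda>m. m > 0 \<and> m \<in> M"] d(1) unfolding d_def[symmetric]
      by auto
    then show ?thesis by auto
  qed
  have "T \<subseteq> M" using shift by (auto simp: M_def)
  then show ?thesis
    using d dvd \<open>N \<in> M\<close> Z(2) by (intro exI[of _ d]) (force simp: M_def)
qed

text \<open>
  The relation makes \<open>degree (\<rho> i) + p ^ i\<close>, for \<open>i \<noteq> 0\<close> and \<open>\<rho> i \<noteq> 0\<close>, the degree of a linear
  combination of the \<open>\<rho> j\<close>.  Assume that degrees above \<open>degree (\<rho> i)\<close> are taken only once; then it is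
  the degree of one of the \<open>\<rho> j\<close>.  Iterating, one walks from \<open>i\<close> to \<open>0\<close> through strictly increasing
  degrees, and \<open>degree (\<rho> 0) - degree (\<rho> i)\<close> is the sum of \<open>p ^ v\<close> over the set \<open>S\<close> of vertices \<open>v \<noteq> 0\<close>
  on the way.  Two indices of equal degree have the same set \<open>S\<close> by uniqueness of the base \<open>p\<close> expansion;
  each of them, unless it is \<open>0\<close>, is the vertex of least degree in \<open>S\<close>, so they coincide.
\<close>

lemma degrees_distinct:
  fixes \<rho> :: "nat \<Rightarrow> 'k::field poly" and b :: "nat \<Rightarrow> nat \<Rightarrow> 'k"
  assumes p: "(p::nat) \<ge> 2"
    and rel: "\<And>i. 0 < i \<Longrightarrow> i < N \<Longrightarrow> (\<Sum>j<N. smult (b j i) (\<rho> j)) = \<rho> i * monom 1 (p ^ i)"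
    and "j < N" "\<rho> j \<noteq> 0"
  shows "\<rho> 0 \<noteq> 0 \<and> (\<forall>k<N. \<rho> k \<noteq> 0 \<longrightarrow> degree (\<rho> k) = degree (\<rho> j) \<longrightarrow> k = j)"
proof -
  \<comment> \<open>\<open>S\<close> collects the vertices \<open>v \<noteq> 0\<close> of a walk from \<open>j\<close> to \<open>0\<close> along which the degree increases.\<close>
  define path where "path j S \<longleftrightarrow> \<rho> 0 \<noteq> 0 \<and> S \<subseteq> {..<N} \<and> (j \<noteq> 0 \<longrightarrow> j \<in> S) \<and>
      degree (\<rho> j) + (\<Sum>v\<in>S. p ^ v) = degree (\<rho> 0) \<and>
      (\<forall>v\<in>S. v = j \<or> degree (\<rho> j) < degree (\<rho> v))" for j S
  \<comment> \<open>The induction goes downwards from the largest degree.\<close>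
  define D where "D = Max ((\<lambda>j. degree (\<rho> j)) ` {..<N})"
  have le_D: "degree (\<rho> j) \<le> D" if "j < N" for j
    unfolding D_def using that by (intro Max_ge) auto
  have "(\<exists>S. path j S) \<and> (\<forall>k<N. \<rho> k \<noteq> 0 \<longrightarrow> degree (\<rho> k) = degree (\<rho> j) \<longrightarrow> k = j)"
    using assms(3,4)
  proof (induction "D - degree (\<rho> j)" arbitrary: j rule: less_induct)
    case (less j)
    have IH: "\<exists>S. path m S" "\<And>k. k < N \<Longrightarrow> \<rho> k \<noteq> 0 \<Longrightarrow> degree (\<rho> k) = degree (\<rho> m) \<Longrightarrow> k = m"
      if "m < N" "\<rho> m \<noteq> 0" "degree (\<rho> j) < degree (\<rho> m)" for m
      using less.hyps[of m] that le_D[of m] by auto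
    have ex_path: "\<exists>S. path i S" if i: "i < N" "\<rho> i \<noteq> 0" "degree (\<rho> i) = degree (\<rho> j)" for i
    proof (cases "i = 0")
      case True
      then have "path i {}" using i by (simp add: path_def)
      then show ?thesis by blast
    next
      case False
      let ?s = "\<Sum>m<N. smult (b m i) (\<rho> m)"
      have s: "?s = \<rho> i * monom 1 (p ^ i)" using rel[of i] False i by simp
      have deg_s: "degree ?s = degree (\<rho> i) + p ^ i"
        unfolding s using i by (simp add: degree_mult_eq degree_monom_eq)
      have pos: "p ^ i > 0" using p by simp
      have "?s \<noteq> 0" unfolding s using i by simp
      then have ex: "\<exists>m\<in>{..<N}. smult (b m i) (\<rho> m) \<noteq> 0" by (meson sum.neutral)
      have "\<exists>m\<in>{..<N}. smult (b m i) (\<rho> m) \<noteq> 0 \<and> degree (smult (b m i) (\<rho> m)) = degree ?s"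
      proof (rule conjunct2[OF degree_sum_distinct[OF _ ex]])
        fix m k
        assume "m \<in> {..<N}" "smult (b m i) (\<rho> m) \<noteq> 0" "degree ?s \<le> degree (smult (b m i) (\<rho> m))"
          "k \<in> {..<N}" "smult (b k i) (\<rho> k) \<noteq> 0"
          "degree (smult (b k i) (\<rho> k)) = degree (smult (b m i) (\<rho> m))"
        then show "k = m"
          using IH(2)[of m k] deg_s i(3) pos by simp
      qed simp
      then obtain m where m': "m < N" "\<rho> m \<noteq> 0" and step: "degree (\<rho> m) = degree (\<rho> i) + p ^ i"
        using deg_s by auto
      have gt: "degree (\<rho> j) < degree (\<rho> m)" using step i(3) pos by simp
      obtain S where S: "path m S" using IH(1)[OF m' gt] by blast
      have "degree (\<rho> i) < degree (\<rho> v)" if "v \<in> S" for v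
        using that S gt i(3) unfolding path_def by (metis order.strict_trans)
      then have "i \<notin> S" by blast
      moreover have "finite S" using S by (auto simp: path_def intro: finite_subset)
      ultimately have "path i (insert i S)"
        using S step i \<open>\<And>v. v \<in> S \<Longrightarrow> degree (\<rho> i) < degree (\<rho> v)\<close>
        unfolding path_def by auto
      then show ?thesis by blast
    qed
    have "k = j" if k: "k < N" "\<rho> k \<noteq> 0" "degree (\<rho> k) = degree (\<rho> j)" for k
    proof -
      obtain S T where S: "path j S" and T: "path k T"
        using ex_path less.prems k by metis
      then have "(\<Sum>v\<in>S. p ^ v) = (\<Sum>v\<in>T. p ^ v)"
        using k(3) unfolding path_def by linarith
      then have "S = T"
        using S T p by (intro sum_powers_inject[of p S N T]) (auto simp: path_def)
      then show ?thesis
        using S T k(3) unfolding path_def by (metis less_irrefl)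
    qed
    then show ?case using ex_path less.prems by blast
  qed
  then show ?thesis by (auto simp: path_def)
qed

text \<open>
  Otherwise the relation for \<open>i\<close> would be a vanishing linear combination of polynomials of distinct
  degrees in which \<open>\<rho> j\<close> occurs.
\<close>

lemma nonzero_of_edge:
  fixes \<rho> :: "nat \<Rightarrow> 'k::field poly" and b :: "nat \<Rightarrow> nat \<Rightarrow> 'k"
  assumes p: "(p::nat) \<ge> 2"
    and rel: "\<And>i. 0 < i \<Longrightarrow> i < N \<Longrightarrow> (\<Sum>j<N. smult (b j i) (\<rho> j)) = \<rho> i * monom 1 (p ^ i)"
    and j: "j < N" "\<rho> j \<noteq> 0" and i: "0 < i" "i < N" "b j i \<noteq> 0"
  shows "\<rho> i \<noteq> 0"
proof
  assume "\<rho> i = 0"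
  then have zero: "(\<Sum>j<N. smult (b j i) (\<rho> j)) = 0" using rel i by simp
  moreover have "(\<Sum>j<N. smult (b j i) (\<rho> j)) \<noteq> 0"
  proof (rule conjunct1[OF degree_sum_distinct])
    show "\<exists>m\<in>{..<N}. smult (b m i) (\<rho> m) \<noteq> 0" using j i by auto
    fix m k
    assume "m \<in> {..<N}" "smult (b m i) (\<rho> m) \<noteq> 0" "k \<in> {..<N}" "smult (b k i) (\<rho> k) \<noteq> 0"
      "degree (smult (b k i) (\<rho> k)) = degree (smult (b m i) (\<rho> m))"
    then show "k = m"
      using degrees_distinct[OF p rel, of m] by auto
  qed simp
  ultimately show False by simp
qed


section \<open>Products of linear factors over a polynomial ring\<close>

lemma freshmans_dream_diff:
  fixes x y :: "'a::comm_ring_1"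
  assumes "prime CHAR('a)"
  shows "(x - y) ^ (CHAR('a) ^ n) = x ^ (CHAR('a) ^ n) - y ^ (CHAR('a) ^ n)"
  using freshmans_dream'[OF assms refl, of "x - y" y n] by (simp add: eq_diff_eq)

lemma smult_sum_right: "smult c (sum f S) = (\<Sum>i\<in>S. smult c (f i))"
  by (rule poly_eqI) (simp add: coeff_sum sum_distrib_left)

lemma infinite_poly: "infinite (UNIV :: 'a::comm_ring_1 poly set)"
proof -
  have "inj (\<lambda>n. monom (1::'a) n)"
    by (rule injI) (metis degree_monom_eq one_neq_zero)
  then show ?thesis
    using finite_imageD[of "\<lambda>n. monom (1::'a) n" UNIV] finite_subset[OF subset_UNIV] infinite_UNIV_nat
    by blast
qed

lemma degree_prod_linear:
  fixes s :: "'b \<Rightarrow> 'a::idom"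
  shows "degree (\<Prod>x\<in>S. [:- s x, 1:]) = card S" "coeff (\<Prod>x\<in>S. [:- s x, 1:]) (card S) = 1"
proof -
  show deg: "degree (\<Prod>x\<in>S. [:- s x, 1:]) = card S"
    by (simp add: degree_prod_eq_sum_degree)
  have "lead_coeff (\<Prod>x\<in>S. [:- s x, 1:]) = 1"
    by (subst lead_coeff_prod) simp
  then show "coeff (\<Prod>x\<in>S. [:- s x, 1:]) (card S) = 1" by (simp add: deg)
qed

text \<open>
  Translation by a zero of \<open>R\<close> permutes the zeros.  Therefore \<open>R (X + t)\<close> and \<open>R X + R t\<close>, which are
  both monic of the same degree, agree on all zeros of \<open>R\<close>, and these are as many as the degree.
\<close>

lemma prod_linear_additive:
  fixes s :: "'b::{ab_group_add,finite} \<Rightarrow> 'a::idom"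
  assumes inj: "inj s" and add: "\<And>x y. s (x + y) = s x + s y"
  defines "R \<equiv> (\<Prod>x\<in>UNIV. [:- s x, 1:])"
  shows "poly R (u + t) = poly R u + poly R t"
proof -
  have deg: "degree R = CARD('b)" "coeff R CARD('b) = 1"
    using degree_prod_linear[of s UNIV] unfolding R_def by auto
  have pos: "CARD('b) > 0" by (simp add: card_gt_0_iff)
  have zero: "poly R (s y) = 0" for y
    unfolding R_def poly_prod by (rule prod_zero) (auto intro: bexI[of _ y])
  have shift: "poly R (s y + t) = poly R t" for y
  proof -
    have "t - s (x - y) = s y + t - s x" for x
      using add[of "x - y" y] by simp
    then have "(\<Prod>x\<in>UNIV. s y + t - s x) = (\<Prod>x\<in>UNIV. t - s x)"
      by (intro prod.reindex_bij_witness[of _ "\<lambda>x. x + y" "\<lambda>x. x - y"]) simp_all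
    then show ?thesis by (simp add: R_def poly_prod)
  qed
  have "pcompose R [:t, 1:] = R + [:poly R t:]"
  proof (rule poly_eqI_degree_lead_coeff[of _ "CARD('b)" _ "range s"])
    have "degree (pcompose R [:t, 1:]) = CARD('b)"
      by (simp add: degree_pcompose deg)
    moreover have "lead_coeff (pcompose R [:t, 1:]) = 1"
      by (subst lead_coeff_comp) (auto simp: deg)
    ultimately show "coeff (pcompose R [:t, 1:]) CARD('b) = coeff (R + [:poly R t:]) CARD('b)"
      using pos by (simp add: deg coeff_pCons split: nat.splits)
    show "degree (pcompose R [:t, 1:]) \<le> CARD('b)" by (simp add: degree_pcompose deg)
    show "degree (R + [:poly R t:]) \<le> CARD('b)" by (intro degree_add_le) (auto simp: deg)
    show "CARD('b) \<le> card (range s)" using inj by (simp add: card_image)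
    show "poly (pcompose R [:t, 1:]) z = poly (R + [:poly R t:]) z" if "z \<in> range s" for z
      using that shift zero by (auto simp: poly_pcompose add.commute[of t])
  qed
  from arg_cong[OF this, of "\<lambda>P. poly P u"] show ?thesis
    by (simp add: poly_pcompose add.commute)
qed

text \<open>
  The product has total degree at most \<open>card S\<close> in the two variables.
\<close>

lemma degree_coeff_prod_linear:
  fixes c :: "'b \<Rightarrow> 'a::comm_ring_1 poly"
  assumes "finite S" and "\<And>x. x \<in> S \<Longrightarrow> degree (c x) \<le> 1"
  shows "degree (coeff (\<Prod>x\<in>S. [:c x, 1:]) m) \<le> card S - m \<and>
    (card S < m \<longrightarrow> coeff (\<Prod>x\<in>S. [:c x, 1:]) m = 0)"
  using assms
proof (induction S arbitrary: m rule: finite_induct)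
  case empty
  then show ?case by (cases m) auto
next
  case (insert x S)
  let ?P = "\<Prod>x\<in>S. [:c x, 1:]"
  have IH: "degree (coeff ?P m) \<le> card S - m" "card S < m \<Longrightarrow> coeff ?P m = 0" for m
    using insert by auto
  have cx: "degree (c x) \<le> 1" using insert.prems by simp
  have coeff: "coeff (\<Prod>x\<in>insert x S. [:c x, 1:]) m
      = c x * coeff ?P m + (case m of 0 \<Rightarrow> 0 | Suc m' \<Rightarrow> coeff ?P m')"
    using insert.hyps by (simp add: coeff_pCons split: nat.splits)
  have "degree (c x * coeff ?P m) \<le> Suc (card S) - m"
  proof (cases "card S < m")
    case False
    have "degree (c x * coeff ?P m) \<le> 1 + (card S - m)"
      using degree_mult_le[of "c x" "coeff ?P m"] cx IH(1)[of m] by linarith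
    then show ?thesis using False by simp
  qed (simp add: IH(2))
  moreover have "degree (case m of 0 \<Rightarrow> 0 | Suc m' \<Rightarrow> coeff ?P m') \<le> Suc (card S) - m"
    using IH(1) by (auto split: nat.splits)
  ultimately show ?case
    unfolding coeff using insert.hyps IH(2)
    by (auto intro!: degree_add_le split: nat.splits)
qed

text \<open>
  Substitution of a constant for the inner variable.
\<close>

definition specialize :: "'a::comm_ring_1 \<Rightarrow> 'a poly poly \<Rightarrow> 'a poly" where
  "specialize y P = map_poly (\<lambda>c. poly c y) P"

lemma coeff_specialize: "coeff (specialize y P) m = poly (coeff P m) y"
  by (simp add: specialize_def coeff_map_poly)

lemma specialize_mult: "specialize y (P * Q) = specialize y P * specialize y Q"
  by (rule poly_eqI) (simp add: coeff_specialize coeff_mult poly_sum)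

lemma specialize_prod: "specialize y (\<Prod>x\<in>S. f x) = (\<Prod>x\<in>S. specialize y (f x))"
  by (induction S rule: infinite_finite_induct)
    (simp_all add: specialize_mult, simp_all add: specialize_def one_pCons map_poly_pCons)

lemma specialize_pCons: "specialize y (pCons c P) = pCons (poly c y) (specialize y P)"
  by (rule poly_eqI) (simp add: coeff_specialize coeff_pCons split: nat.splits)

lemma poly_specialize: "poly (specialize y P) (poly u y) = poly (poly P u) y"
  by (induction P) (simp_all add: specialize_pCons, simp add: specialize_def)

section \<open>Additive maps all of whose determined directions have large fibres\<close>

locale additive_map =
  fixes f :: "'k::{field,finite} \<Rightarrow> 'k" and N :: nat
  assumes card: "CARD('k) = CHAR('k) ^ N"
    and add: "f (x + y) = f x + f y"
begin

text \<open>
  The form \<open>f x - x Y\<close>, dual to the point \<open>(x, f x)\<close> of the graph of \<open>f\<close>.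
\<close>

definition line :: "'k \<Rightarrow> 'k poly" where
  "line x = [:f x, - x:]"

text \<open>
  The polynomial \<open>X ^ CARD('k) - X\<close> is subtracted from the Redei polynomial because the latter
  equals it at every direction that \<open>f\<close> does not determine; moreover the result has a smaller degree.
\<close>

definition redei :: "'k poly poly" where
  "redei = (\<Prod>x\<in>UNIV. [:- line x, 1:]) - (monom 1 CARD('k) - monom 1 1)"

lemma prime_char: "prime CHAR('k)" by (rule prime_CHAR_finite_field)
lemma char_ge_2: "CHAR('k) \<ge> 2" using prime_char by (rule prime_ge_2_nat)
lemma prime_char_poly: "prime CHAR('k poly)" using prime_char by simp

lemma line_add: "line (x + y) = line x + line y"
  by (simp add: line_def add)

lemma inj_line: "inj line"
  by (auto simp: inj_def line_def)

lemma line_monom: "line x = [:f x:] - monom x 1"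
  by (simp add: line_def monom_altdef)

lemma line_power: "line x ^ (CHAR('k) ^ j) = [:f x ^ (CHAR('k) ^ j):] - monom (x ^ (CHAR('k) ^ j)) (CHAR('k) ^ j)"
  using freshmans_dream_diff[OF prime_char_poly, of "[:f x:]" "monom x 1" j]
  by (simp add: line_monom monom_power poly_const_pow)

lemma redei_line: "poly redei (line x) = smult x (monom 1 CARD('k) - monom 1 1)"
proof -
  have "poly (\<Prod>z\<in>UNIV. [:- line z, 1:]) (line x) = 0"
    unfolding poly_prod by (rule prod_zero) (auto intro: exI[of _ x])
  moreover have "line x ^ CARD('k) = [:f x:] - monom x CARD('k)"
    using line_power[of x N] finite_field_power_card[of "f x"] finite_field_power_card[of x]
    by (simp add: card[symmetric])
  ultimately show ?thesis
    by (simp add: redei_def poly_monom smult_diff_right smult_monom) (simp add: line_monom)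
qed

lemma degree_redei_less: "degree redei < CARD('k)"
proof -
  let ?P = "\<Prod>x\<in>UNIV. [:- line x, 1:]"
  have Q: "CARD('k) > 1" using card_field_ge2[where ?'k = 'k] by linarith
  have "coeff redei CARD('k) = 0"
    using degree_prod_linear(2)[of line UNIV] Q by (simp add: redei_def)
  moreover have "degree redei \<le> CARD('k)"
    unfolding redei_def using Q degree_prod_linear(1)[of line UNIV]
    by (intro degree_diff_le) (auto intro: order.trans[OF degree_monom_le])
  ultimately show ?thesis
    using Q by (metis degree_0 le_neq_implies_less leading_coeff_0_iff less_trans zero_less_one)
qed

lemma redei_support:
  assumes "coeff redei m \<noteq> 0"
  shows "\<exists>k<N. m = CHAR('k) ^ k"
proof -
  have "poly redei (x + t) = poly redei x + poly redei t" for x t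
    using prod_linear_additive[OF inj_line line_add, of x t]
      freshmans_dream'[OF prime_char_poly, of "CARD('k)" N x t] card
    by (simp add: redei_def poly_monom)
  then obtain k where k: "m = CHAR('k) ^ k"
    using additive_poly_coeff[of redei m] infinite_poly prime_char_poly assms by auto
  have "CHAR('k) ^ k < CHAR('k) ^ N"
    using le_degree[OF assms] degree_redei_less card k by simp
  then have "k < N" using char_ge_2 by simp
  with k show ?thesis by blast
qed

lemma poly_redei: "poly redei u = (\<Sum>j<N. coeff redei (CHAR('k) ^ j) * u ^ (CHAR('k) ^ j))"
  using redei_support char_ge_2 by (rule poly_additive_expansion)

text \<open>
  Expand \<open>redei\<close> at \<open>f x - x Y\<close> into powers of \<open>x\<close>, with exponents reduced by means of
  \<open>x ^ CARD('k) = x\<close>, and compare coefficients, which is legitimate coefficientwise in \<open>Y\<close>.  The value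
  \<open>x (Y ^ CARD('k) - Y)\<close> contributes to \<open>x ^ 1\<close> only, whence the restriction to \<open>i > 0\<close>.
\<close>

lemma redei_recurrence:
  assumes i: "0 < i" "i < N"
  shows "(\<Sum>j<N. smult (frob_coeff f ((i + N - j) mod N) ^ (CHAR('k) ^ j)) (coeff redei (CHAR('k) ^ j)))
    = coeff redei (CHAR('k) ^ i) * monom 1 (CHAR('k) ^ i)"
proof -
  define b where "b j i = frob_coeff f ((i + N - j) mod N) ^ (CHAR('k) ^ j)" for i j
  define \<rho> where "\<rho> j = coeff redei (CHAR('k) ^ j)" for j
  have f_power: "f x ^ (CHAR('k) ^ j) = (\<Sum>i<N. b j i * x ^ (CHAR('k) ^ i))" if "j < N" for x j
  proof -
    have "f x ^ (CHAR('k) ^ j) = (\<Sum>k<N. frob_coeff f k ^ (CHAR('k) ^ j) * x ^ (CHAR('k) ^ ((k + j) mod N)))"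
      unfolding additive_expansion[of N f x, OF card add] freshmans_dream_sum'[OF prime_char refl]
      by (simp add: power_mult_distrib power_frobenius_mod[OF card, symmetric] power_add power_mult)
    also have "\<dots> = (\<Sum>i<N. frob_coeff f ((i + N - j) mod N) ^ (CHAR('k) ^ j) * x ^ (CHAR('k) ^ i))"
      using that by (rule sum_shift_mod)
    finally show ?thesis by (simp add: b_def)
  qed
  \<comment> \<open>The coefficient of \<open>x ^ p ^ i\<close> in the difference of the two expressions for \<open>redei\<close> at \<open>f x - x Y\<close>.\<close>
  define e where "e i = (\<Sum>j<N. smult (b j i) (\<rho> j)) - \<rho> i * monom 1 (CHAR('k) ^ i)
      - (if i = 0 then monom 1 CARD('k) - monom 1 1 else 0)" for i
  have N: "N > 0" using i by simp
  have monom: "monom (x ^ n) m = smult (x ^ n) (monom 1 m)" for x :: 'k and n m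
    by (simp add: smult_monom)
  have "(\<Sum>i<N. smult (x ^ (CHAR('k) ^ i)) (e i)) = 0" for x
  proof -
    have "poly redei (line x)
        = (\<Sum>j<N. \<rho> j * ([:\<Sum>i<N. b j i * x ^ (CHAR('k) ^ i):] - monom (x ^ (CHAR('k) ^ j)) (CHAR('k) ^ j)))"
      unfolding poly_redei line_power \<rho>_def by (intro sum.cong) (simp_all add: f_power)
    also have "\<dots> = (\<Sum>j<N. \<Sum>i<N. smult (x ^ (CHAR('k) ^ i)) (smult (b j i) (\<rho> j)))
        - (\<Sum>j<N. smult (x ^ (CHAR('k) ^ j)) (\<rho> j * monom 1 (CHAR('k) ^ j)))"
      by (simp add: right_diff_distrib sum_subtractf smult_sum monom mult.commute[of "\<rho> _" "[:_:]"]
          mult.commute[of "x ^ _"])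
    also have "(\<Sum>j<N. \<Sum>i<N. smult (x ^ (CHAR('k) ^ i)) (smult (b j i) (\<rho> j)))
        = (\<Sum>i<N. smult (x ^ (CHAR('k) ^ i)) (\<Sum>j<N. smult (b j i) (\<rho> j)))"
      by (subst sum.swap) (simp add: smult_sum_right)
    finally have "(\<Sum>i<N. smult (x ^ (CHAR('k) ^ i)) (\<Sum>j<N. smult (b j i) (\<rho> j)))
        - (\<Sum>i<N. smult (x ^ (CHAR('k) ^ i)) (\<rho> i * monom 1 (CHAR('k) ^ i))) = smult x (monom 1 CARD('k) - monom 1 1)"
      by (simp add: redei_line)
    moreover have "(\<Sum>i<N. smult (x ^ (CHAR('k) ^ i)) (if i = 0 then monom 1 CARD('k) - monom 1 1 else 0))
        = smult x (monom 1 CARD('k) - monom 1 1)"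
      using N by (subst sum.remove[of _ 0]) auto
    ultimately show ?thesis
      by (simp add: e_def smult_diff_right sum_subtractf)
  qed
  then have zero: "(\<Sum>i<N. coeff (e i) n * x ^ (CHAR('k) ^ i)) = 0" for x n
    by (metis (no_types, lifting) coeff_0 coeff_smult coeff_sum mult.commute sum.cong)
  have "coeff (e i) n = 0" for n
    using frob_coeff_unique[OF card, of "\<lambda>_. 0" "\<lambda>i. coeff (e i) n" i]
      frob_coeff_unique[OF card, of "\<lambda>_. 0" "\<lambda>i. 0" i] zero[of n] i by simp
  then have "e i = 0" by (intro poly_eqI) simp
  then show ?thesis using i by (simp add: e_def b_def \<rho>_def)
qed

text \<open>
  The coefficient vanishes at every \<open>y\<close>, for one of two reasons.  If \<open>x \<mapsto> f x - x y\<close> is injective,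
  its values exhaust the field, and all of them are zeros of the specialization, whose degree is too
  small.  If not, its kernel gives at least \<open>p ^ W\<close> factors \<open>X\<close> in the product.  The degree of the
  coefficient in \<open>Y\<close> is less than the order of the field.
\<close>

lemma redei_coeff_zero:
  assumes W: "CHAR('k) ^ W \<le> CARD('k)"
    and fib: "\<And>x. x \<noteq> 0 \<Longrightarrow> CHAR('k) ^ W \<le> card {z. f z * x = f x * z}"
    and m: "1 < m" "m < CHAR('k) ^ W"
  shows "coeff redei m = 0"
proof -
  have "poly (coeff redei m) y = 0" for y
  proof (cases "inj (\<lambda>x. f x - x * y)")
    case True
    have "poly (specialize y redei) z = 0" for z
    proof -
      obtain x where x: "z = f x - x * y"
        using True finite_UNIV_inj_surj[OF _ True] by (auto dest: surjD)
      have "poly (specialize y redei) (poly (line x) y) = x * (y ^ CARD('k) - y)"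
        unfolding poly_specialize redei_line by (simp add: poly_monom)
      then show ?thesis by (simp add: finite_field_power_card x line_def mult.commute[of x y])
    qed
    moreover have "degree (specialize y redei) < CARD('k)"
      using degree_redei_less by (simp add: specialize_def) (meson map_poly_degree_leq le_less_trans)
    ultimately have "specialize y redei = 0"
      by (intro poly_eqI_degree[of UNIV]) auto
    then show ?thesis by (metis coeff_0 coeff_specialize)
  next
    case False
    then obtain x1 x2 where ne: "x1 \<noteq> x2" and eq: "f x1 - x1 * y = f x2 - x2 * y"
      by (auto simp: inj_def)
    have "f (x1 - x2) = f x1 - f x2"
      using add[of "x1 - x2" x2] by simp
    also have "\<dots> = x1 * y - x2 * y"
      using eq by (simp add: algebra_simps)
    finally have x: "x1 - x2 \<noteq> 0" "f (x1 - x2) = (x1 - x2) * y"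
      using ne by (auto simp: left_diff_distrib)
    define D where "D = {z. f z - z * y = 0}"
    have "{z. f z * (x1 - x2) = f (x1 - x2) * z} = D"
      unfolding x(2) D_def using x(1) by auto
    then have D: "CHAR('k) ^ W \<le> card D" using fib[OF x(1)] by simp
    have "specialize y (\<Prod>x\<in>UNIV. [:- line x, 1:]) = (\<Prod>x\<in>UNIV. [:- (f x - x * y), 1:])"
      by (simp add: specialize_prod specialize_pCons line_def) (simp add: specialize_def one_pCons mult.commute[of y])
    also have "\<dots> = (\<Prod>x\<in>D. [:- (f x - x * y), 1:]) * (\<Prod>x\<in>-D. [:- (f x - x * y), 1:])"
      by (subst prod.union_disjoint[symmetric]) auto
    also have "(\<Prod>x\<in>D. [:- (f x - x * y), 1:]) = (\<Prod>x\<in>D. [:0, 1:])"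
      by (intro prod.cong) (auto simp: D_def)
    also have "\<dots> = monom 1 (card D)" by (simp add: monom_altdef)
    finally have "coeff (specialize y (\<Prod>x\<in>UNIV. [:- line x, 1:])) m = 0"
      using D m by (simp add: coeff_monom_mult)
    then have "poly (coeff (\<Prod>x\<in>UNIV. [:- line x, 1:]) m) y = 0"
      by (simp only: coeff_specialize)
    then show ?thesis using m W by (simp add: redei_def)
  qed
  moreover have "degree (coeff redei m) < CARD('k)"
  proof -
    have "coeff redei m = coeff (\<Prod>x\<in>UNIV. [:- line x, 1:]) m"
      using m W by (simp add: redei_def)
    moreover have "degree (coeff (\<Prod>x\<in>UNIV. [:- line x, 1:]) m) \<le> CARD('k) - m"
      using degree_coeff_prod_linear[of UNIV "\<lambda>x. - line x" m] by (simp add: line_def)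
    ultimately show ?thesis using m W by simp
  qed
  ultimately show ?thesis
    by (intro poly_eqI_degree[of UNIV]) auto
qed

text \<open>
  The indices of the nonzero coefficients of \<open>redei\<close> are closed under adding, modulo \<open>N\<close>, an exponent
  that occurs in \<open>f\<close>; and they avoid \<open>1, ..., W - 1\<close>.  Since \<open>0\<close> is one of them, so is, modulo \<open>N\<close>, the
  least positive element of the group spanned by \<open>N\<close> and these exponents.
\<close>

lemma support_multiple:
  assumes fib: "\<And>x. x \<noteq> 0 \<Longrightarrow> CHAR('k) ^ W \<le> card {z. f z * x = f x * z}"
  shows "\<exists>d. W \<le> d \<and> 0 < d \<and> d dvd N \<and> (\<forall>k<N. frob_coeff f k \<noteq> 0 \<longrightarrow> d dvd k)"
proof -
  define \<rho> where "\<rho> j = coeff redei (CHAR('k) ^ j)" for j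
  define Z where "Z = {j. j < N \<and> \<rho> j \<noteq> 0}"
  have Q: "CARD('k) > 1" using card_field_ge2[where ?'k = 'k] by linarith
  have "CHAR('k) ^ W \<le> CARD('k)"
    using fib[of 1] card_mono[of UNIV "{z. f z * 1 = f 1 * z}"] by simp
  then have W: "W \<le> N" using char_ge_2 by (simp add: card)
  have rel: "(\<Sum>j<N. smult (frob_coeff f ((i + N - j) mod N) ^ (CHAR('k) ^ j)) (\<rho> j)) = \<rho> i * monom 1 (CHAR('k) ^ i)"
    if "0 < i" "i < N" for i
    using redei_recurrence[OF that] by (simp add: \<rho>_def)
  obtain j where j: "j < N" "\<rho> j \<noteq> 0"
  proof (rule ccontr)
    assume "\<not> thesis"
    then have "poly redei (line 1) = 0"
      using that unfolding poly_redei \<rho>_def by (intro sum.neutral) auto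
    then have "monom 1 CARD('k) - monom 1 1 = (0 :: 'k poly)" by (simp add: redei_line)
    then show False using Q by (metis coeff_0 coeff_diff coeff_monom diff_zero less_irrefl one_neq_zero)
  qed
  have "\<rho> 0 \<noteq> 0"
    using degrees_distinct[OF char_ge_2 rel j] by blast
  then have Z: "Z \<subseteq> {..<N}" "0 \<in> Z" using j by (auto simp: Z_def)
  have "(j + k) mod N \<in> Z" if "j \<in> Z" "k \<in> {k. k < N \<and> frob_coeff f k \<noteq> 0}" for j k
  proof (cases "(j + k) mod N = 0")
    case False
    let ?i = "(j + k) mod N"
    have jk: "j < N" "\<rho> j \<noteq> 0" "k < N" "frob_coeff f k \<noteq> 0" using that by (auto simp: Z_def)
    have "(?i + N - j) mod N = k"
      using unshift_mod[of j N k] jk by (simp add: add.commute)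
    then have "\<rho> ?i \<noteq> 0"
      using jk False by (intro nonzero_of_edge[OF char_ge_2 rel jk(1,2)]) auto
    then show ?thesis using jk by (simp add: Z_def)
  qed (use Z in simp)
  from closed_under_shifts[OF Z this] obtain d where
    d: "d > 0" "d dvd N" "\<forall>k\<in>{k. k < N \<and> frob_coeff f k \<noteq> 0}. d dvd k" "d mod N \<in> Z"
    by blast
  have "W \<le> d"
  proof (cases "d = N")
    case False
    then have "d < N" using d(1,2) j(1) dvd_imp_le[of d N] by simp
    then have "\<rho> d \<noteq> 0" using d(4) by (simp add: Z_def)
    then show ?thesis
      using redei_coeff_zero[OF \<open>CHAR('k) ^ W \<le> CARD('k)\<close> fib, of "CHAR('k) ^ d"] d(1) char_ge_2
      unfolding \<rho>_def by (meson not_le one_less_power order_less_le_trans power_strict_increasing pos2 one_less_numeral_iff semiring_norm(76))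
  qed (use W in simp)
  then show ?thesis using d by auto
qed

end


section \<open>Fixed fields of powers of Frobenius\<close>

lemma card_roots_power_eq:
  fixes z :: "'a::{comm_ring_1,ring_no_zero_divisors}"
  assumes "t > 0"
  shows "card {x. x ^ t = z} \<le> t"
proof -
  let ?P = "monom 1 t - [:z:]"
  have "coeff ?P t = 1" using assms by (simp add: coeff_pCons split: nat.splits)
  then have "?P \<noteq> 0" by (metis coeff_0 zero_neq_one)
  have "degree ?P \<le> t" by (intro degree_diff_le) (auto simp: degree_monom_le)
  moreover have "{x. poly ?P x = 0} = {x. x ^ t = z}" by (auto simp: poly_monom)
  ultimately show ?thesis using card_poly_roots_bound[OF \<open>?P \<noteq> 0\<close>] by simp
qed

lemma card_frobenius_fixed_le:
  fixes p g :: nat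
  assumes "p \<ge> 2" and "g > 0"
  shows "card {x :: 'a::{comm_ring_1,ring_no_zero_divisors}. x ^ (p ^ g) = x} \<le> p ^ g"
proof -
  have "1 < p ^ g" using assms by (intro one_less_power) auto
  let ?P = "monom (1::'a) (p ^ g) - monom 1 1"
  have "coeff ?P (p ^ g) = 1" using \<open>1 < p ^ g\<close> by simp
  then have "?P \<noteq> 0" by (metis coeff_0 zero_neq_one)
  have "degree ?P \<le> p ^ g"
    using \<open>1 < p ^ g\<close> by (intro degree_diff_le order.trans[OF degree_monom_le]) auto
  moreover have "{x. poly ?P x = 0} = {x. x ^ (p ^ g) = x}" by (auto simp: poly_monom)
  ultimately show ?thesis using card_poly_roots_bound[OF \<open>?P \<noteq> 0\<close>] by simp
qed

lemma minus_one_dvd_power_minus_one: "(x::nat) - 1 dvd x ^ j - 1"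
proof (cases "x = 0")
  case False
  show ?thesis
  proof (induction j)
    case (Suc j)
    have "x ^ Suc j - 1 = x * (x ^ j - 1) + (x - 1)"
      using False by (cases "x ^ j") (auto simp: algebra_simps)
    then show ?case using Suc by simp
  qed simp
qed (cases j; simp)

text \<open>
  If \<open>t = (p ^ N - 1) / (p ^ d - 1)\<close>, then \<open>t\<close>-th powers of nonzero elements are fixed, and at most \<open>t\<close>
  elements share a \<open>t\<close>-th power.
\<close>

lemma card_frobenius_fixed_ge:
  assumes N: "CARD('k::{field,finite}) = p ^ N" and p: "p \<ge> 2" and d: "d dvd N" "d > 0"
  shows "p ^ d \<le> card {c :: 'k. c ^ (p ^ d) = c}"
proof -
  obtain j where j: "N = d * j" using d by blast
  obtain t where t: "CARD('k) - 1 = (p ^ d - 1) * t"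
    using minus_one_dvd_power_minus_one[of "p ^ d" j] unfolding N j power_mult by blast
  have "t > 0" using t card_field_ge2[where ?'k = 'k] by (cases t) auto
  let ?I = "(\<lambda>c. c ^ t) ` (UNIV - {0 :: 'k})"
  have "(p ^ d - 1) * t = card (UNIV - {0 :: 'k})"
    using t by (simp add: card_Diff_singleton)
  also have "\<dots> \<le> card (\<Union>z\<in>?I. {c. c ^ t = z})"
    by (intro card_mono) auto
  also have "\<dots> \<le> (\<Sum>z\<in>?I. card {c. c ^ t = z})" by (rule card_UN_le) simp
  also have "\<dots> \<le> (\<Sum>z\<in>?I. t)" by (intro sum_mono card_roots_power_eq \<open>t > 0\<close>)
  finally have "p ^ d - 1 \<le> card ?I" using \<open>t > 0\<close> by simp
  moreover have "card (insert 0 ?I) = Suc (card ?I)"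
    by (rule card_insert_disjoint) auto
  moreover have "insert 0 ?I \<subseteq> {c. c ^ (p ^ d) = c}"
  proof -
    have pos: "p ^ d > 0" using p by simp
    have "(c ^ t) ^ (p ^ d) = c ^ t" if "c \<noteq> 0" for c :: 'k
    proof -
      have "(c ^ t) ^ (p ^ d - 1) = 1"
        using power_card_minus_one[of c, unfolded t] that by (metis mult.commute power_mult)
      then show ?thesis using pos by (metis One_nat_def Suc_pred mult.right_neutral power_Suc)
    qed
    then show ?thesis using pos by auto
  qed
  then have "card (insert 0 ?I) \<le> card {c :: 'k. c ^ (p ^ d) = c}"
    by (intro card_mono) auto
  ultimately show ?thesis by linarith
qed

text \<open>
  Elements of the subfield are fixed by the \<open>d\<close>-th and the \<open>N\<close>-th power of Frobenius, hence by the
  power with exponent \<open>gcd d N\<close>, which fixes at most \<open>p ^ gcd d N\<close> elements.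
\<close>

lemma subfield_degree_dvd:
  fixes E :: "'k::{field,finite} set"
  assumes N: "CARD('k) = p ^ N" and p: "p \<ge> 2" and E: "is_subfield E" "card E = p ^ d"
  shows "d dvd N"
proof -
  \<comment> \<open>A subfield has at least two elements, so \<open>d\<close> is not \<open>0\<close>.\<close>
  have "card {0, 1 :: 'k} \<le> card E"
    using E by (intro card_mono) (auto simp: is_subfield_def)
  then have "d \<noteq> 0" using E(2) by (cases d) auto
  define g where "g = gcd d N"
  obtain a b where ab: "d * a = N * b + g"
    using bezout_nat[OF \<open>d \<noteq> 0\<close>, of N] by (auto simp: g_def)
  have "x ^ (p ^ g) = x" if "x \<in> E" for x
  proof -
    have "x ^ (p ^ (d * i)) = x" for i
      by (induction i)
        (simp_all add: power_add power_mult subfield_power_card[OF E(1) that] flip: E(2))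
    moreover have "x ^ (p ^ (N * b + g)) = x ^ (p ^ g)"
      using power_frobenius_mod[OF N, of x "N * b + g"] power_frobenius_mod[OF N, of x g] by simp
    ultimately show ?thesis using ab by metis
  qed
  then have "E \<subseteq> {x. x ^ (p ^ g) = x}" by blast
  then have "card E \<le> card {x :: 'k. x ^ (p ^ g) = x}" by (intro card_mono) auto
  also have "\<dots> \<le> p ^ g"
    using \<open>d \<noteq> 0\<close> by (intro card_frobenius_fixed_le[OF p]) (simp add: g_def)
  finally have "p ^ d \<le> p ^ g" by (simp add: E(2))
  then have "d \<le> g" using p by simp
  moreover have "g dvd d" by (simp add: g_def)
  ultimately have "g = d" using \<open>d \<noteq> 0\<close> dvd_imp_le by (metis antisym neq0_conv)
  then show ?thesis by (metis g_def gcd_dvd2)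
qed

section \<open>Vector spaces over a finite field\<close>

text \<open>
  Finitely many generic conditions can be met at once when there are more scalars than conditions:
  \<open>comb c x y\<close> stands for \<open>x + c y\<close>, and along the line through \<open>x\<close> and \<open>y\<close> a condition that
  holds at \<open>x\<close> or at \<open>y\<close> fails for at most one \<open>c\<close>.
\<close>

lemma generic_element:
  fixes comb :: "'c::finite \<Rightarrow> 'x \<Rightarrow> 'x \<Rightarrow> 'x"
  assumes T: "finite T" "card T < CARD('c)" and "A \<noteq> {}"
    and closed: "\<And>c x y. x \<in> A \<Longrightarrow> y \<in> A \<Longrightarrow> comb c x y \<in> A"
    and few: "\<And>k x y c c'. k \<in> T \<Longrightarrow> x \<in> A \<Longrightarrow> y \<in> A \<Longrightarrow> good k x \<or> good k y \<Longrightarrow>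
      \<not> good k (comb c x y) \<Longrightarrow> \<not> good k (comb c' x y) \<Longrightarrow> c = c'"
    and ex: "\<And>k. k \<in> T \<Longrightarrow> \<exists>x\<in>A. good k x"
  shows "\<exists>x\<in>A. \<forall>k\<in>T. good k x"
proof -
  have "\<exists>x\<in>A. \<forall>k\<in>T'. good k x" if "T' \<subseteq> T" for T'
    using finite_subset[OF that T(1)] that
  proof (induction T' rule: finite_induct)
    case empty
    then show ?case using \<open>A \<noteq> {}\<close> by auto
  next
    case (insert k S)
    obtain x where x: "x \<in> A" "\<forall>j\<in>S. good j x" using insert by auto
    obtain y where y: "y \<in> A" "good k y" using ex[of k] insert by auto
    let ?C = "\<lambda>j. {c. \<not> good j (comb c x y)}"
    have "card (?C j) \<le> 1" if "j \<in> insert k S" for j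
    proof -
      have "c = c'" if "c \<in> ?C j" "c' \<in> ?C j" for c c'
        using few[of j x y c c'] that x y insert.prems \<open>j \<in> insert k S\<close> by auto
      then show ?thesis by (simp add: card_le_Suc0_iff_eq)
    qed
    then have "(\<Sum>j\<in>insert k S. card (?C j)) \<le> (\<Sum>j\<in>insert k S. 1)" by (rule sum_mono)
    then have "card (\<Union>j\<in>insert k S. ?C j) \<le> card (insert k S)"
      using card_UN_le[of "insert k S" ?C] insert.hyps by simp
    also have "\<dots> \<le> card T" using insert.prems T by (intro card_mono) auto
    finally have "(\<Union>j\<in>insert k S. ?C j) \<noteq> UNIV" using T(2) by auto
    then obtain c where "\<forall>j\<in>insert k S. good j (comb c x y)" by blast
    then show ?case using closed x y by blast
  qed
  then show ?thesis by blast
qed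

lemma card_span_independent:
  fixes scale :: "'a::{field,finite} \<Rightarrow> 'v::ab_group_add \<Rightarrow> 'v"
  assumes "vector_space scale" and "finite B" and "\<not> module.dependent scale B"
  shows "finite (module.span scale B) \<and> card (module.span scale B) = CARD('a) ^ card B"
proof -
  interpret vector_space scale by fact
  show ?thesis using assms(2,3)
  proof (induction B rule: finite_induct)
    case (insert b B)
    have indep: "independent B" "b \<notin> span B"
      using insert by (auto simp: independent_insert)
    have IH: "finite (span B)" "card (span B) = CARD('a) ^ card B"
      using insert.IH indep by auto
    let ?f = "\<lambda>(c, x). scale c b + x"
    have span: "span (insert b B) = ?f ` (UNIV \<times> span B)"
    proof (intro equalityI subsetI)
      fix x assume "x \<in> span (insert b B)"
      then obtain k where "x - scale k b \<in> span B" by (auto simp: span_insert)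
      then show "x \<in> ?f ` (UNIV \<times> span B)"
        by (intro image_eqI[of _ _ "(k, x - scale k b)"]) auto
    next
      fix x assume "x \<in> ?f ` (UNIV \<times> span B)"
      then obtain c y where "x = scale c b + y" "y \<in> span B" by auto
      then have "x - scale c b \<in> span B" by simp
      then show "x \<in> span (insert b B)" by (auto simp: span_insert)
    qed
    have inj: "inj_on ?f (UNIV \<times> span B)"
    proof (rule inj_onI, clarsimp)
      fix c x c' x' assume x: "x \<in> span B" "x' \<in> span B" and eq: "scale c b + x = scale c' b + x'"
      have "scale (c - c') b = x' - x" using eq by (simp add: scale_left_diff_distrib algebra_simps)
      then have "scale (c - c') b \<in> span B" using x by (simp add: span_diff)
      then have "c = c'"
        using indep(2) span_scale[of "scale (c - c') b" B "inverse (c - c')"] by (cases "c = c'") auto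
      with eq show "c = c' \<and> x = x'" by simp
    qed
    show ?case
      unfolding span using IH inj insert.hyps
      by (simp add: card_image card_cartesian_product)
  qed simp
qed

lemma card_subspace:
  fixes scale :: "'a::{field,finite} \<Rightarrow> 'v::ab_group_add \<Rightarrow> 'v"
  assumes "vector_space scale" and "module.subspace scale S"
    and "finite S \<or> vector_space.dim scale S > 0"
  shows "finite S \<and> card S = CARD('a) ^ vector_space.dim scale S"
proof -
  interpret vector_space scale by fact
  obtain B where B: "B \<subseteq> S" "independent B" "S \<subseteq> span B" "card B = dim S"
    by (rule basis_exists)
  have "span B = S" using B assms(2) by (metis span_minimal subset_antisym)
  moreover have "finite B" using assms(3) B by (metis card_gt_0_iff finite_subset)
  ultimately show ?thesis using card_span_independent[OF assms(1) _ B(2)] B(4) by simp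
qed

lemma linear_functionals_separate:
  fixes scale :: "'k::field \<Rightarrow> 'v::ab_group_add \<Rightarrow> 'v"
  assumes "vector_space scale" and eq: "\<And>\<phi>. Vector_Spaces.linear scale (*) \<phi> \<Longrightarrow> \<phi> u = \<phi> v"
  shows "u = v"
proof -
  interpret vector_space scale by fact
  let ?B = "extend_basis {}"
  have B: "independent ?B" "span ?B = UNIV"
    using independent_extend_basis[OF independent_empty] span_extend_basis[OF independent_empty] by auto
  have "representation ?B u b = representation ?B v b" for b
    by (rule eq[OF linear_representation[OF B]])
  then have "representation ?B u = representation ?B v" by blast
  moreover have "(\<Sum>b | representation ?B x b \<noteq> 0. scale (representation ?B x b) b) = x" for x
    by (rule sum_nonzero_representation_eq[OF B(1)]) (simp add: B(2))
  ultimately show ?thesis by metis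
qed


section \<open>Additive maps of vector spaces\<close>

text \<open>
  For a functional \<open>\<phi>\<close> and a vector \<open>y\<close> let \<open>a k \<phi> y\<close> be the coefficients of the additive map
  \<open>l \<mapsto> \<phi> (\<gamma> (l y))\<close>.  They are linear in \<open>\<phi>\<close> and semilinear in \<open>y\<close>, so for a generic pair all those
  coefficients are nonzero that do not vanish identically.  The lemma on a single additive map,
  applied to this pair, thus yields a common divisor \<open>d\<close> of all exponents for all pairs.
\<close>

lemma linear_over_fixed_field:
  fixes scale :: "'k::{field,finite} \<Rightarrow> 'v::ab_group_add \<Rightarrow> 'v"
  assumes vs: "vector_space scale" and card: "CARD('k) = CHAR('k) ^ N"
    and \<gamma>_add: "\<And>u v. \<gamma> (u + v) = \<gamma> u + \<gamma> v"
    and fib: "\<And>y. CHAR('k) ^ W \<le> card {c. \<gamma> (scale c y) = scale c (\<gamma> y)}"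
  shows "\<exists>d\<ge>W. 0 < d \<and> d dvd N \<and>
    (\<forall>c y. c ^ (CHAR('k) ^ d) = c \<longrightarrow> \<gamma> (scale c y) = scale c (\<gamma> y))"
proof -
  interpret vector_space scale by fact
  let ?p = "CHAR('k)"
  have p: "prime ?p" by (rule prime_CHAR_finite_field)
  define \<Phi> where "\<Phi> = {\<phi>. Vector_Spaces.linear scale (*) \<phi>}"
  have \<Phi>_add: "\<phi> (u + v) = \<phi> u + \<phi> v" and \<Phi>_scale: "\<phi> (scale c u) = c * \<phi> u"
    if "\<phi> \<in> \<Phi>" for \<phi> u v c
  proof -
    interpret Vector_Spaces.linear scale "(*)" \<phi> using that by (simp add: \<Phi>_def)
    show "\<phi> (u + v) = \<phi> u + \<phi> v" "\<phi> (scale c u) = c * \<phi> u" by (rule add scale)+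
  qed
  have \<Phi>_comb: "(\<lambda>v. \<phi> v + c * \<psi> v) \<in> \<Phi>" if "\<phi> \<in> \<Phi>" "\<psi> \<in> \<Phi>" for \<phi> \<psi> c
    unfolding \<Phi>_def mem_Collect_eq
    by unfold_locales (simp_all add: \<Phi>_add[OF that(1)] \<Phi>_add[OF that(2)] \<Phi>_scale[OF that(1)] \<Phi>_scale[OF that(2)] algebra_simps)
  have "(\<lambda>_. 0) \<in> \<Phi>"
    unfolding \<Phi>_def mem_Collect_eq by unfold_locales (simp_all add: algebra_simps)
  define h where "h \<phi> y l = \<phi> (\<gamma> (scale l y))" for \<phi> :: "'v \<Rightarrow> 'k" and y l
  define a where "a k \<phi> y = frob_coeff (h \<phi> y) k" for k \<phi> y
  have h: "additive_map (h \<phi> y) N" if "\<phi> \<in> \<Phi>" for \<phi> y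
    by unfold_locales (simp_all add: h_def card scale_left_distrib \<gamma>_add \<Phi>_add[OF that])
  have expansion: "h \<phi> y l = (\<Sum>k<N. a k \<phi> y * l ^ (?p ^ k))" if "\<phi> \<in> \<Phi>" for \<phi> y l
    unfolding a_def using additive_map.add[OF h[OF that]] by (rule additive_expansion[OF card])
  have a_vector: "a k \<phi> (y + scale c z) = a k \<phi> y + c ^ (?p ^ k) * a k \<phi> z"
    if "\<phi> \<in> \<Phi>" "k < N" for k \<phi> y c z
  proof -
    have split: "h \<phi> (y + scale c z) l = h \<phi> y l + h \<phi> z (l * c)" for l
      by (simp add: h_def scale_right_distrib \<gamma>_add \<Phi>_add[OF that(1)])
    have "h \<phi> (y + scale c z) l = (\<Sum>k<N. (a k \<phi> y + c ^ (?p ^ k) * a k \<phi> z) * l ^ (?p ^ k))" for l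
      unfolding split unfolding expansion[OF that(1)]
      by (simp add: power_mult_distrib sum.distrib algebra_simps)
    then show ?thesis unfolding a_def[of k \<phi> "y + scale c z"]
      by (rule frob_coeff_unique[OF card]) fact
  qed
  have a_functional: "a k (\<lambda>v. \<phi> v + c * \<psi> v) y = a k \<phi> y + c * a k \<psi> y"
    if "\<phi> \<in> \<Phi>" "\<psi> \<in> \<Phi>" "k < N" for k \<phi> \<psi> c y
  proof -
    have "h (\<lambda>v. \<phi> v + c * \<psi> v) y l = h \<phi> y l + c * h \<psi> y l" for l
      by (simp add: h_def)
    then have "h (\<lambda>v. \<phi> v + c * \<psi> v) y l = (\<Sum>k<N. (a k \<phi> y + c * a k \<psi> y) * l ^ (?p ^ k))" for l
      by (simp add: expansion that sum.distrib sum_distrib_left algebra_simps)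
    then show ?thesis unfolding a_def[of k "\<lambda>v. \<phi> v + c * \<psi> v"]
      by (rule frob_coeff_unique[OF card]) fact
  qed

  \<comment> \<open>The exponents that occur for at least one pair.\<close>
  define T where "T = {k. k < N \<and> (\<exists>\<phi>\<in>\<Phi>. \<exists>y. a k \<phi> y \<noteq> 0)}"
  have "card T \<le> card {..<N}" by (intro card_mono) (auto simp: T_def)
  also have "card {..<N} < CARD('k)"
    using p unfolding card card_lessThan by (intro power_gt_expt) (simp add: prime_gt_Suc_0_nat)
  finally have T: "finite T" "card T < CARD('k)" by (auto simp: T_def)

  \<comment> \<open>First a vector is chosen for which every exponent in \<open>T\<close> occurs with some functional, then
    one functional that serves all of them.\<close>
  have "\<exists>y\<in>UNIV. \<forall>k\<in>T. \<exists>\<phi>\<in>\<Phi>. a k \<phi> y \<noteq> 0"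
  proof (rule generic_element[where comb = "\<lambda>c y z. y + scale c z", OF T])
    fix k y z c c'
    assume k: "k \<in> T" and good: "(\<exists>\<phi>\<in>\<Phi>. a k \<phi> y \<noteq> 0) \<or> (\<exists>\<phi>\<in>\<Phi>. a k \<phi> z \<noteq> 0)"
      and "\<not> (\<exists>\<phi>\<in>\<Phi>. a k \<phi> (y + scale c z) \<noteq> 0)" "\<not> (\<exists>\<phi>\<in>\<Phi>. a k \<phi> (y + scale c' z) \<noteq> 0)"
    then have zero: "a k \<phi> y + c ^ (?p ^ k) * a k \<phi> z = 0" "a k \<phi> y + c' ^ (?p ^ k) * a k \<phi> z = 0"
      if "\<phi> \<in> \<Phi>" for \<phi>
      using that a_vector[of \<phi> k y] k by (auto simp: T_def)
    show "c = c'"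
    proof (rule ccontr)
      assume "c \<noteq> c'"
      then have ne: "(c - c') ^ (?p ^ k) \<noteq> 0" by simp
      have "(c - c') ^ (?p ^ k) * a k \<phi> z = 0" if "\<phi> \<in> \<Phi>" for \<phi>
        using zero[OF that] unfolding freshmans_dream_diff[OF p] left_diff_distrib
        by (metis add_diff_cancel_left diff_self)
      then have "a k \<phi> z = 0" if "\<phi> \<in> \<Phi>" for \<phi> using ne that by auto
      then show False using good zero(1) by auto
    qed
  qed (auto simp: T_def)
  then obtain y where y: "\<And>k. k \<in> T \<Longrightarrow> \<exists>\<phi>\<in>\<Phi>. a k \<phi> y \<noteq> 0" by blast
  have "\<exists>\<phi>\<in>\<Phi>. \<forall>k\<in>T. a k \<phi> y \<noteq> 0"
  proof (rule generic_element[where comb = "\<lambda>c \<phi> \<psi>. (\<lambda>v. \<phi> v + c * \<psi> v)", OF T])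
    show "\<Phi> \<noteq> {}" using \<open>(\<lambda>_. 0) \<in> \<Phi>\<close> by blast
    fix k \<phi> \<psi> c c'
    assume k: "k \<in> T" "\<phi> \<in> \<Phi>" "\<psi> \<in> \<Phi>" and good: "a k \<phi> y \<noteq> 0 \<or> a k \<psi> y \<noteq> 0"
      and "\<not> a k (\<lambda>v. \<phi> v + c * \<psi> v) y \<noteq> 0" "\<not> a k (\<lambda>v. \<phi> v + c' * \<psi> v) y \<noteq> 0"
    then have zero: "a k \<phi> y + c * a k \<psi> y = 0" "a k \<phi> y + c' * a k \<psi> y = 0"
      using a_functional[of \<phi> \<psi> k] by (auto simp: T_def)
    then have "c * a k \<psi> y = c' * a k \<psi> y" by (metis add_left_cancel)
    then show "c = c'" using zero good by auto
  qed (use \<Phi>_comb y in auto)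
  then obtain \<phi> where \<phi>: "\<phi> \<in> \<Phi>" "\<And>k. k \<in> T \<Longrightarrow> a k \<phi> y \<noteq> 0" by blast

  have "?p ^ W \<le> card {l. h \<phi> y l * x = h \<phi> y x * l}" if "x \<noteq> 0" for x
  proof -
    let ?L = "{c. \<gamma> (scale c (scale x y)) = scale c (\<gamma> (scale x y))}"
    have "?p ^ W \<le> card ?L" by (rule fib)
    also have "\<dots> = card ((\<lambda>c. c * x) ` ?L)"
      using that by (intro card_image[symmetric] inj_onI) simp
    also have "\<dots> \<le> card {l. h \<phi> y l * x = h \<phi> y x * l}"
      by (intro card_mono) (auto simp: h_def \<Phi>_scale[OF \<phi>(1)] mult_ac)
    finally show ?thesis .
  qed
  from additive_map.support_multiple[OF h[OF \<phi>(1)] this]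
  obtain d where d: "W \<le> d" "0 < d" "d dvd N" "\<And>k. k < N \<Longrightarrow> a k \<phi> y \<noteq> 0 \<Longrightarrow> d dvd k"
    by (auto simp: a_def)
  \<comment> \<open>Every exponent of every pair is a multiple of \<open>d\<close>, so a scalar fixed by the \<open>d\<close>-th power of
    Frobenius can be pulled out of all the maps; functionals separate vectors.\<close>
  have "\<gamma> (scale c v) = scale c (\<gamma> v)" if c: "c ^ (?p ^ d) = c" for c v
  proof (rule linear_functionals_separate[OF vs])
    fix \<psi> assume "Vector_Spaces.linear scale (*) \<psi>"
    then have \<psi>: "\<psi> \<in> \<Phi>" by (simp add: \<Phi>_def)
    have c_power: "c ^ (?p ^ (d * i)) = c" for i
      by (induction i) (simp_all add: power_add power_mult c)
    have "a k \<psi> v * c ^ (?p ^ k) = c * a k \<psi> v" if "k < N" for k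
    proof (cases "a k \<psi> v = 0")
      case False
      then have "k \<in> T" using that \<psi> by (auto simp: T_def)
      then have "d dvd k" using d(4) \<phi>(2) that by blast
      then show ?thesis using c_power by (auto simp: mult.commute)
    qed simp
    then have "h \<psi> v c = c * h \<psi> v 1"
      unfolding expansion[OF \<psi>] sum_distrib_left by (intro sum.cong) auto
    then show "\<psi> (\<gamma> (scale c v)) = \<psi> (scale c (\<gamma> v))"
      by (simp add: h_def \<Phi>_scale[OF \<psi>])
  qed
  then show ?thesis using d by blast
qed

section \<open>Additive subgroups whose points all have large weight\<close>

text \<open>
  Enlarge \<open>W\<close>, one dimension at a time, without meeting \<open>U\<close> outside \<open>0\<close>.  A vector \<open>v\<close> can be adjoined unless
  it has the form \<open>w + c u\<close> with \<open>w \<in> W\<close>, \<open>u \<in> U\<close> and a scalar \<open>c\<close>; there are too few of these as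
  long as the dimension of \<open>W\<close> is less than \<open>r - a\<close>.  At dimension \<open>r - a\<close>, differences of elements of \<open>U\<close>
  and \<open>W\<close> fill the space by counting.
\<close>

lemma complement_avoiding:
  fixes scale :: "'k::{field,finite} \<Rightarrow> 'v::ab_group_add \<Rightarrow> 'v"
  assumes vs: "vector_space scale" and V: "finite (UNIV :: 'v set)" "CARD('v) = CARD('k) ^ r"
    and U: "0 \<in> U" "\<And>u v. u \<in> U \<Longrightarrow> v \<in> U \<Longrightarrow> u - v \<in> U" "card U = CARD('k) ^ a"
  shows "\<exists>W. module.subspace scale W \<and> W \<inter> U = {0} \<and> (\<forall>v. \<exists>w\<in>W. v + w \<in> U)"
proof -
  interpret vector_space scale by fact
  let ?Q = "CARD('k)"
  have Q: "?Q > 1" using card_field_ge2[where ?'k = 'k] by linarith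
  have finV: "finite A" for A :: "'v set" using V(1) by (rule finite_subset[OF subset_UNIV])
  have "card U \<le> CARD('v)" by (intro card_mono V(1)) auto
  then have a: "a \<le> r" using Q U(3) V(2) by simp
  have "\<exists>W. subspace W \<and> card W = ?Q ^ k \<and> W \<inter> U = {0}" if "k \<le> r - a" for k
    using that
  proof (induction k)
    case 0
    show ?case by (rule exI[of _ "{0}"]) (use U(1) in auto)
  next
    case (Suc k)
    then obtain W where W: "subspace W" "card W = ?Q ^ k" "W \<inter> U = {0}" by auto
    \<comment> \<open>The pairs \<open>(0, 0)\<close> and \<open>(1, 0)\<close> both give \<open>c u = 0\<close>; dropping one of them makes the
      count of the vectors \<open>w + c u\<close> strictly smaller than the order of the space.\<close>
    let ?S = "UNIV \<times> U - {(1 :: 'k, 0)}"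
    let ?bad = "(\<lambda>(w, c, u). w + scale c u) ` (W \<times> ?S)"
    have "card ?S < ?Q * ?Q ^ a"
      using U finV[of U] Q by (simp add: card_Diff_singleton card_cartesian_product)
    then have "card W * card ?S < ?Q ^ k * (?Q * ?Q ^ a)"
      using Q by (simp add: W(2))
    moreover have "card ?bad \<le> card W * card ?S"
      using card_image_le[of "W \<times> ?S" "\<lambda>(w, c, u). w + scale c u"] finV by (simp add: card_cartesian_product)
    moreover have "?Q ^ k * (?Q * ?Q ^ a) \<le> CARD('v)"
    proof -
      have "?Q ^ (k + Suc a) \<le> ?Q ^ r" using Q Suc.prems a by (intro power_increasing) auto
      then show ?thesis by (simp add: V(2) power_add mult_ac)
    qed
    ultimately have "?bad \<noteq> UNIV" by auto
    then obtain v where v: "v \<notin> ?bad" by blast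
    have v_avoids: "v \<noteq> w + scale c u" if "w \<in> W" "u \<in> U" for w c u
    proof (cases "(c, u) = (1, 0)")
      case True
      have "v \<noteq> w + scale 0 0"
        using v that U(1) by (force simp: image_iff)
      then show ?thesis using True by simp
    next
      case False
      then show ?thesis using v that by (force simp: image_iff)
    qed
    let ?f = "\<lambda>(c, w). w + scale c v"
    define W' where "W' = ?f ` (UNIV \<times> W)"
    have mem: "x \<in> W' \<longleftrightarrow> (\<exists>c. \<exists>w\<in>W. x = w + scale c v)" for x by (auto simp: W'_def)
    have "subspace W'"
    proof (rule subspaceI)
      show "0 \<in> W'" unfolding mem using subspace_0[OF W(1)] by (intro exI[of _ 0] bexI[of _ 0]) auto
      fix x y assume "x \<in> W'" "y \<in> W'"
      then obtain c w c' w' where "x = w + scale c v" "y = w' + scale c' v" "w \<in> W" "w' \<in> W"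
        unfolding mem by blast
      then show "x + y \<in> W'" unfolding mem using subspace_add[OF W(1), of w w']
        by (intro exI[of _ "c + c'"] bexI[of _ "w + w'"]) (auto simp: scale_left_distrib)
    next
      fix b x assume "x \<in> W'"
      then obtain c w where "x = w + scale c v" "w \<in> W" unfolding mem by blast
      then show "scale b x \<in> W'" unfolding mem using subspace_scale[OF W(1), of w b]
        by (intro exI[of _ "b * c"] bexI[of _ "scale b w"]) (auto simp: scale_right_distrib)
    qed
    moreover have "inj_on ?f (UNIV \<times> W)"
    proof (rule inj_onI, clarsimp)
      fix c w c' w' assume w: "w \<in> W" "w' \<in> W" and eq: "w + scale c v = w' + scale c' v"
      have "c = c'"
      proof (rule ccontr)
        assume "c \<noteq> c'"
        have "scale (c - c') v = w' - w" using eq by (simp add: scale_left_diff_distrib algebra_simps)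
        then have "scale (inverse (c - c')) (scale (c - c') v) = scale (inverse (c - c')) (w' - w)" by simp
        then have "v = scale (inverse (c - c')) (w' - w)" using \<open>c \<noteq> c'\<close> by simp
        then show False
          using v_avoids[of "scale (inverse (c - c')) (w' - w)" 0 0] U(1) w W(1)
          by (auto simp: subspace_diff subspace_scale)
      qed
      with eq show "c = c' \<and> w = w'" by simp
    qed
    then have "card W' = ?Q ^ Suc k" by (simp add: W'_def card_image card_cartesian_product W(2))
    moreover have "W' \<inter> U = {0}"
    proof (intro equalityI subsetI)
      fix x assume x: "x \<in> W' \<inter> U"
      then have "x \<in> W'" by blast
      then obtain c w where cw: "x = w + scale c v" "w \<in> W" unfolding mem by blast
      have "c = 0"
      proof (rule ccontr)
        assume "c \<noteq> 0"
        have "scale (inverse c) (scale c v) = scale (inverse c) (x - w)" using cw by simp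
        then have "v = scale (inverse c) (- w) + scale (inverse c) x"
          using \<open>c \<noteq> 0\<close> by (simp add: scale_right_diff_distrib)
        then show False
          using v_avoids[of "scale (inverse c) (- w)" x "inverse c"] cw x W(1)
          by (auto simp: subspace_neg subspace_scale)
      qed
      then show "x \<in> {0}" using cw x W(3) by auto
    qed (use \<open>subspace W'\<close> U(1) in \<open>auto simp: subspace_0\<close>)
    ultimately show ?case by blast
  qed
  then obtain W where W: "subspace W" "card W = ?Q ^ (r - a)" "W \<inter> U = {0}" by blast
  let ?g = "\<lambda>(u, w). u - w"
  have "inj_on ?g (U \<times> W)"
  proof (rule inj_onI, clarsimp)
    fix u w u' w' assume mem: "u \<in> U" "w \<in> W" "u' \<in> U" "w' \<in> W" and eq: "u - w = u' - w'"
    have "u - u' = w - w'" using eq by (simp add: algebra_simps)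
    then have "u - u' \<in> W \<inter> U" using U(2)[of u u'] mem subspace_diff[OF W(1), of w w'] by simp
    then show "u = u' \<and> w = w'" using W(3) eq by auto
  qed
  then have "card (?g ` (U \<times> W)) = CARD('v)"
    using a by (simp add: card_image card_cartesian_product U(3) W(2) V(2) flip: power_add)
  then have surj: "?g ` (U \<times> W) = UNIV" using V(1) by (intro card_subset_eq) auto
  have "\<exists>w\<in>W. v + w \<in> U" for v
  proof -
    have "v \<in> ?g ` (U \<times> W)" using surj by simp
    then obtain u w where "v = u - w" "u \<in> U" "w \<in> W" by auto
    then show ?thesis by (intro bexI[of _ w]) auto
  qed
  then show ?thesis using W by blast
qed

text \<open>
  Given the complement \<open>X\<close>, the additive map \<open>\<gamma>\<close> with values in \<open>X\<close> and \<open>v + \<gamma> v \<in> U\<close> vanishes exactly on \<open>U\<close>.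
  If \<open>c\<close> maps \<open>y + \<gamma> y\<close> into \<open>U\<close>, then \<open>\<gamma> (c y) = c \<gamma> y\<close>, as \<open>X\<close> is closed under scalars.
\<close>

lemma subgroup_closed_under_fixed_field:
  fixes scale :: "'k::{field,finite} \<Rightarrow> 'v::ab_group_add \<Rightarrow> 'v"
  assumes vs: "vector_space scale" and card: "CARD('k) = CHAR('k) ^ N"
    and V: "finite (UNIV :: 'v set)" "CARD('v) = CARD('k) ^ r"
    and U: "0 \<in> U" "\<And>u v. u \<in> U \<Longrightarrow> v \<in> U \<Longrightarrow> u - v \<in> U" "card U = CARD('k) ^ a"
    and weight: "\<And>u. u \<in> U \<Longrightarrow> CHAR('k) ^ W \<le> card {c. scale c u \<in> U}"
  shows "\<exists>d\<ge>W. 0 < d \<and> d dvd N \<and> (\<forall>c. c ^ (CHAR('k) ^ d) = c \<longrightarrow> (\<forall>u\<in>U. scale c u \<in> U))"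
proof -
  interpret vector_space scale by fact
  obtain X where X: "subspace X" "X \<inter> U = {0}" "\<And>v. \<exists>w\<in>X. v + w \<in> U"
    using complement_avoiding[OF vs V U] by blast
  have U_add: "u + v \<in> U" if "u \<in> U" "v \<in> U" for u v
    using U(2)[of u "0 - v"] U(2)[of 0 v] U(1) that by simp
  obtain \<gamma> where \<gamma>: "\<And>v. \<gamma> v \<in> X" "\<And>v. v + \<gamma> v \<in> U" using X(3) by metis
  have \<gamma>_eqI: "\<gamma> v = w" if "w \<in> X" "v + w \<in> U" for v w
  proof -
    have "\<gamma> v - w \<in> X" using subspace_diff[OF X(1)] \<gamma>(1) that(1) by blast
    moreover have "\<gamma> v - w \<in> U" using U(2)[OF \<gamma>(2)[of v] that(2)] by simp
    ultimately have "\<gamma> v - w = 0" using X(2) by blast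
    then show ?thesis by simp
  qed
  have "\<exists>d\<ge>W. 0 < d \<and> d dvd N \<and> (\<forall>c y. c ^ (CHAR('k) ^ d) = c \<longrightarrow> \<gamma> (scale c y) = scale c (\<gamma> y))"
  proof (rule linear_over_fixed_field[OF vs card])
    fix u v
    show "\<gamma> (u + v) = \<gamma> u + \<gamma> v"
    proof (rule \<gamma>_eqI)
      show "\<gamma> u + \<gamma> v \<in> X" using \<gamma>(1) by (intro subspace_add[OF X(1)])
      show "u + v + (\<gamma> u + \<gamma> v) \<in> U"
        using U_add[OF \<gamma>(2)[of u] \<gamma>(2)[of v]] by (simp add: algebra_simps)
    qed
  next
    fix y
    have "CHAR('k) ^ W \<le> card {c. scale c (y + \<gamma> y) \<in> U}" by (rule weight[OF \<gamma>(2)])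
    also have "\<dots> \<le> card {c. \<gamma> (scale c y) = scale c (\<gamma> y)}"
      using \<gamma>(1) subspace_scale[OF X(1)]
      by (intro card_mono) (auto simp: scale_right_distrib intro!: \<gamma>_eqI)
    finally show "CHAR('k) ^ W \<le> card {c. \<gamma> (scale c y) = scale c (\<gamma> y)}" .
  qed
  then obtain d where d: "d \<ge> W" "0 < d" "d dvd N"
    and lin: "\<And>c y. c ^ (CHAR('k) ^ d) = c \<Longrightarrow> \<gamma> (scale c y) = scale c (\<gamma> y)" by blast
  have "scale c u \<in> U" if "c ^ (CHAR('k) ^ d) = c" "u \<in> U" for c u
  proof -
    have "\<gamma> u = 0" using that(2) subspace_0[OF X(1)] by (intro \<gamma>_eqI) auto
    then show ?thesis using \<gamma>(2)[of "scale c u"] lin[OF that(1), of u] by simp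
  qed
  then show ?thesis using d by blast
qed


section \<open>Linear sets\<close>

definition stabilizer :: "('k \<Rightarrow> 'v \<Rightarrow> 'v) \<Rightarrow> 'v set \<Rightarrow> 'k set" where
  "stabilizer scale U = {c. \<forall>u\<in>U. scale c u \<in> U}"

lemma is_subfield_stabilizer:
  fixes scale :: "'k::{field,finite} \<Rightarrow> 'v::ab_group_add \<Rightarrow> 'v"
  assumes "vector_space scale"
    and U: "0 \<in> U" "\<And>u v. u \<in> U \<Longrightarrow> v \<in> U \<Longrightarrow> u - v \<in> U"
  shows "is_subfield (stabilizer scale U)"
proof -
  interpret vector_space scale by fact
  have neg: "- u \<in> U" if "u \<in> U" for u using U(2)[OF U(1) that] by simp
  have add: "u + v \<in> U" if "u \<in> U" "v \<in> U" for u v using U(2)[OF that(1) neg[OF that(2)]] by simp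
  have mult: "c * d \<in> stabilizer scale U" if "c \<in> stabilizer scale U" "d \<in> stabilizer scale U" for c d
    using that by (simp add: stabilizer_def flip: scale_scale)
  have one: "1 \<in> stabilizer scale U" by (simp add: stabilizer_def)
  have power: "c ^ m \<in> stabilizer scale U" if "c \<in> stabilizer scale U" for c m
    by (induction m) (use one mult that in auto)
  have inv: "inverse c \<in> stabilizer scale U" if "c \<in> stabilizer scale U" for c
  proof (cases "c = 0")
    case False
    \<comment> \<open>The inverse is a power of \<open>c\<close>.\<close>
    have "c * c ^ (CARD('k) - 2) = c ^ Suc (CARD('k) - 2)" by simp
    also have "Suc (CARD('k) - 2) = CARD('k) - 1" using card_field_ge2[where ?'k = 'k] by simp
    finally have "c * c ^ (CARD('k) - 2) = 1" using False by (simp only: power_card_minus_one if_False)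
    then have "inverse c = c ^ (CARD('k) - 2)" by (rule inverse_unique)
    then show ?thesis using power[OF that] by simp
  qed (use that in simp)
  show ?thesis
    unfolding is_subfield_def using mult one inv neg add U(1)
    by (auto simp: stabilizer_def scale_left_distrib)
qed

text \<open>
  The scalars \<open>c\<close> with \<open>c u \<in> U\<close> correspond to the vectors of \<open>U\<close> on the point spanned by \<open>u\<close>.
\<close>

lemma card_point_inter:
  fixes \<iota> :: "'f::{field,finite} \<Rightarrow> 'k::{field,finite}"
    and scale :: "'k \<Rightarrow> 'v::ab_group_add \<Rightarrow> 'v"
  assumes \<iota>: "field_embedding \<iota>" and vs: "vector_space scale" and fin: "finite U"
    and U: "module.subspace (restrict_scalars \<iota> scale) U" and "u \<noteq> 0"
  shows "card {c. scale c u \<in> U} = CARD('f) ^ point_weight \<iota> scale U (module.span scale {u})"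
proof -
  interpret vector_space scale by fact
  interpret F: vector_space "restrict_scalars \<iota> scale"
    using \<iota> vs by (rule vector_space_restrict_scalars)
  have "span {u} \<inter> U = (\<lambda>c. scale c u) ` {c. scale c u \<in> U}"
    by (auto simp: span_singleton)
  moreover have "card \<dots> = card {c. scale c u \<in> U}"
    using \<open>u \<noteq> 0\<close> by (intro card_image inj_onI) simp
  moreover have "F.subspace (span {u})"
    by (rule F.subspaceI)
      (auto simp: restrict_scalars_def intro: span_zero span_add span_scale)
  then have "card (span {u} \<inter> U) = CARD('f) ^ F.dim (span {u} \<inter> U)"
    using card_subspace[OF F.vector_space_axioms F.subspace_inter[OF _ U]] fin by blast
  ultimately show ?thesis by (simp add: point_weight_def)
qed

theorem theorem1:
  fixes \<iota> :: "'f::{field,finite} \<Rightarrow> 'k::{field,finite}"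
    and scale :: "'k \<Rightarrow> 'v::ab_group_add \<Rightarrow> 'v"
    and U :: "'v set"
    and q n r a w :: nat
  assumes "primepow q" and "n \<ge> 1" and "r \<ge> 2" and "1 \<le> a" and "a \<le> r - 1"
    and "card (UNIV :: 'f set) = q" and "card (UNIV :: 'k set) = q ^ n"
    and "field_embedding \<iota>"
    and "vector_space scale" and "vector_space.dim scale (UNIV :: 'v set) = r"
    and "module.subspace (restrict_scalars \<iota> scale) U"
    and "vector_space.dim (restrict_scalars \<iota> scale) U = a * n"
    and "\<forall>P \<in> linear_set scale U. w \<le> point_weight \<iota> scale U P"
    and "\<forall>w'. (\<forall>P \<in> linear_set scale U. w' \<le> point_weight \<iota> scale U P) \<longrightarrow> w' \<le> w"
    and "w \<ge> 2"
  shows "w dvd n \<and>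
    (\<exists>K. is_subfield K \<and> card K = q ^ w \<and> subspace_over scale K U)"
proof -
  note \<iota> = \<open>field_embedding \<iota>\<close> and vs = \<open>vector_space scale\<close>
  interpret vector_space scale by fact
  interpret F: vector_space "restrict_scalars \<iota> scale"
    using \<iota> vs by (rule vector_space_restrict_scalars)
  note F_subspace = \<open>module.subspace (restrict_scalars \<iota> scale) U\<close>
  have q: "q \<ge> 2" using card_field_ge2[where ?'k = 'f] assms(6) by simp
  obtain p e where pe: "prime p" "e > 0" "q = p ^ e"
    using \<open>primepow q\<close> by (auto simp: primepow_def)
  have cardK: "CARD('k) = p ^ (e * n)" using assms(7) pe by (simp add: power_mult)
  then have p: "CHAR('k) = p" by (rule CHAR_eq_of_card[OF pe(1)])
  have p2: "p \<ge> 2" using pe(1) by (rule prime_ge_2_nat)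

  have V: "finite (UNIV :: 'v set)" "CARD('v) = CARD('k) ^ r"
    using card_subspace[OF vs subspace_UNIV] assms(3,10) by auto
  have finU: "finite U" using V(1) by (rule finite_subset[OF subset_UNIV])
  have U: "0 \<in> U" "\<And>u v. u \<in> U \<Longrightarrow> v \<in> U \<Longrightarrow> u - v \<in> U"
    using F.subspace_0[OF F_subspace] F.subspace_diff[OF F_subspace] by auto
  have "card U = q ^ (a * n)"
    using card_subspace[OF F.vector_space_axioms F_subspace] finU assms(6,12) by simp
  then have cardU: "card U = CARD('k) ^ a" by (simp add: assms(7) mult.commute flip: power_mult)

  note card_weight = card_point_inter[OF \<iota> vs finU F_subspace, unfolded assms(6)]
  have weight: "q ^ w \<le> card {c. scale c u \<in> U}" if "u \<in> U" "u \<noteq> 0" for u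
  proof -
    have "span {u} \<in> linear_set scale U" using that by (auto simp: linear_set_def)
    then have "w \<le> point_weight \<iota> scale U (span {u})" using assms(13) by blast
    then show ?thesis using card_weight[OF that(2)] q by (simp add: power_increasing)
  qed
  have "card U > 1"
    unfolding cardU using card_field_ge2[where ?'k = 'k] assms(4) by (intro one_less_power) auto
  then have "U \<noteq> {0}" by auto
  then obtain u0 where u0: "u0 \<in> U" "u0 \<noteq> 0" using U(1) by blast
  \<comment> \<open>For the zero vector every scalar qualifies, and the field has at least \<open>q ^ w\<close> elements
    because the linear set has a point.\<close>
  have "CHAR('k) ^ (e * w) \<le> card {c. scale c u \<in> U}" if "u \<in> U" for u
  proof (cases "u = 0")
    case True
    have "q ^ w \<le> card {c. scale c u0 \<in> U}" by (rule weight[OF u0])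
    also have "\<dots> \<le> card {c. scale c u \<in> U}" using True U(1) by (intro card_mono) auto
    finally show ?thesis by (simp add: p pe(3) power_mult)
  qed (use weight[OF that] in \<open>simp add: p pe(3) power_mult\<close>)
  from subgroup_closed_under_fixed_field[OF vs _ V U cardU this, of "e * n"]
  obtain d where d: "d \<ge> e * w" "0 < d" "d dvd e * n" "\<And>c u. c ^ (p ^ d) = c \<Longrightarrow> u \<in> U \<Longrightarrow> scale c u \<in> U"
    unfolding p using cardK by blast

  define E where "E = stabilizer scale U"
  have E: "is_subfield E" unfolding E_def using vs U by (rule is_subfield_stabilizer)
  have "p ^ d \<le> card {c :: 'k. c ^ (p ^ d) = c}"
    using cardK p2 d(3,2) by (rule card_frobenius_fixed_ge)
  also have "\<dots> \<le> card E" using d(4) by (intro card_mono) (auto simp: E_def stabilizer_def)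
  finally have "p ^ d \<le> card E" .
  moreover have "p ^ (e * w) \<le> p ^ d" using d(1) p2 by (intro power_increasing) auto
  ultimately have "p ^ (e * w) \<le> card E" by simp
  then have E_ge: "q ^ w \<le> card E" by (simp add: pe(3) power_mult)

  have vsK: "vector_space ((*) :: 'k \<Rightarrow> 'k \<Rightarrow> 'k)" by unfold_locales (simp_all add: algebra_simps)
  interpret K: vector_space "restrict_scalars \<iota> ((*) :: 'k \<Rightarrow> 'k \<Rightarrow> 'k)"
    using \<iota> vsK by (rule vector_space_restrict_scalars)
  have \<iota>_E: "\<iota> c \<in> E" for c
    using F.subspace_scale[OF F_subspace] by (auto simp: E_def stabilizer_def restrict_scalars_def)
  have "K.subspace E"
    using E \<iota>_E by (intro K.subspaceI) (auto simp: is_subfield_def restrict_scalars_def)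
  then obtain m where m: "card E = q ^ m"
    using card_subspace[OF K.vector_space_axioms, of E] assms(6) by auto

  \<comment> \<open>The multiples of \<open>u\<close> by elements of \<open>E\<close> lie in \<open>U\<close> and on the point spanned by \<open>u\<close>.\<close>
  have "m \<le> point_weight \<iota> scale U P" if P: "P \<in> linear_set scale U" for P
  proof -
    obtain u where u: "P = span {u}" "u \<in> U" "u \<noteq> 0" using P by (auto simp: linear_set_def)
    have "q ^ m \<le> card {c. scale c u \<in> U}"
      unfolding m[symmetric] using u by (intro card_mono) (auto simp: E_def stabilizer_def)
    then show ?thesis using card_weight[OF u(3)] q u(1) by simp
  qed
  then have "m \<le> w" using assms(14) by blast
  moreover have "w \<le> m" using E_ge q by (simp add: m)
  ultimately have mw: "m = w" by simp
  have "card E = p ^ (e * w)" by (simp add: m mw pe(3) power_mult)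
  then have "e * w dvd e * n" by (rule subfield_degree_dvd[OF cardK p2 E])
  then have "w dvd n" using pe(2) by simp
  moreover have "subspace_over scale E U"
    using F.subspace_0[OF F_subspace] F.subspace_add[OF F_subspace]
    by (auto simp: subspace_over_def E_def stabilizer_def)
  ultimately show ?thesis using E m mw by blast
qed

end
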